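(* Let $G\le \mathrm{Aut}(\mathcal{T}_d)$ be a finitely generated, coarsely diagonal, self-similar group. Then the Röver–Nekrashevych group $V_d(G)$ has finite abelianization.
   Context: Let $X$ be an alphabet with $d\ge 2$ letters, identified with $\{1,\dots,d\}$ and totally ordered; $X^*$ (finite words) is the vertex set of the rooted $d$-ary tree $\mathcal{T}_d$ (root the empty word, $u$ adjacent to $ux$), ordered lexicographically. Every $f\in\mathrm{Aut}(\mathcal{T}_d)$ has a wreath recursion $f=\rho(f)(f_1,\dots,f_d)$ with $\rho(f)\in S_d$, $f_i\in\mathrm{Aut}(\mathcal{T}_d)$ determined by $f(iw)=\rho(f)(i)f_i(w)$; the $f_i$ are the level-1 states, and the states of $f$ form the smallest set containing $f$ closed under taking level-1 states. $G$ is self-similar if it contains all states of its elements, and coarsely diagonal if for every $g\in G$ and every state $g'$ of $g$, the element $(g')^{-1}g$ has finite order. Let $X^\omega$ be the set of infinite words. A finite subtree is rooted if it contains the root and complete if $ux\in T$ implies $uy\in T$ for all $y\in X$. For finite complete rooted subtrees $T_-,T_+$ with $n$ leaves $u_1,\dots,u_n$ and $v_1,\dots,v_n$ (lexicographic order), $\sigma\in S_n$, $g_i\in G$, $[T_-,\sigma(g_1,\dots,g_n),T_+]$ denotes the homeomorphism of $X^\omega$ with $v_iw\mapsto u_{\sigma(i)}g_i(w)$; $V_d(G)$ is the group of all such homeomorphisms. *)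

theory Defs
  imports "HOL-Algebra.Algebra" "HOL-Library.List_Lexorder"
begin

definition words :: "nat \<Rightarrow> nat list set" where
  "words d = {w. set w \<subseteq> {..<d}}"

definition tree_adj :: "nat \<Rightarrow> nat list \<Rightarrow> nat list \<Rightarrow> bool" where
  "tree_adj d u v \<longleftrightarrow> (\<exists>x<d. v = u @ [x]) \<or> (\<exists>x<d. u = v @ [x])"

(* automorphism of the rooted tree T_d (graph automorphism fixing the root),
   extended by the identity outside X* so that equality is extensional *)
definition is_tree_aut :: "nat \<Rightarrow> (nat list \<Rightarrow> nat list) \<Rightarrow> bool" where
  "is_tree_aut d f \<longleftrightarrow> bij_betw f (words d) (words d) \<and> f [] = []
     \<and> (\<forall>u\<in>words d. \<forall>v\<in>words d. tree_adj d u v \<longleftrightarrow> tree_adj d (f u) (f v))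
     \<and> (\<forall>w. w \<notin> words d \<longrightarrow> f w = w)"

definition aut_group :: "nat \<Rightarrow> (nat list \<Rightarrow> nat list) monoid" where
  "aut_group d = \<lparr>carrier = {f. is_tree_aut d f}, monoid.mult = (\<circ>), one = id\<rparr>"

(* section (state) of f at the word u:  f(u w) = f(u) (f|_u)(w) *)
definition tsection :: "nat \<Rightarrow> (nat list \<Rightarrow> nat list) \<Rightarrow> nat list \<Rightarrow> (nat list \<Rightarrow> nat list)" where
  "tsection d f u = (\<lambda>w. if w \<in> words d then drop (length u) (f (u @ w)) else w)"

inductive_set states :: "nat \<Rightarrow> (nat list \<Rightarrow> nat list) \<Rightarrow> (nat list \<Rightarrow> nat list) set"
  for d f where
  self: "f \<in> states d f"
| level1: "g \<in> states d f \<Longrightarrow> i < d \<Longrightarrow> tsection d g [i] \<in> states d f"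

definition self_similar :: "nat \<Rightarrow> (nat list \<Rightarrow> nat list) set \<Rightarrow> bool" where
  "self_similar d G \<longleftrightarrow> (\<forall>g\<in>G. states d g \<subseteq> G)"

definition coarsely_diagonal :: "nat \<Rightarrow> (nat list \<Rightarrow> nat list) set \<Rightarrow> bool" where
  "coarsely_diagonal d G \<longleftrightarrow> (\<forall>g\<in>G. \<forall>g'\<in>states d g.
     \<exists>n::nat. n > 0 \<and>
       (inv\<^bsub>aut_group d\<^esub> g' \<otimes>\<^bsub>aut_group d\<^esub> g) [^]\<^bsub>aut_group d\<^esub> n = \<one>\<^bsub>aut_group d\<^esub>)"

definition finitely_generated :: "('a, 'b) monoid_scheme \<Rightarrow> 'a set \<Rightarrow> bool" where
  "finitely_generated A H \<longleftrightarrow> (\<exists>S. finite S \<and> S \<subseteq> H \<and> generate A S = H)"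

definition inf_words :: "nat \<Rightarrow> (nat \<Rightarrow> nat) set" where
  "inf_words d = {w. \<forall>n. w n < d}"

definition cons_inf :: "nat list \<Rightarrow> (nat \<Rightarrow> nat) \<Rightarrow> (nat \<Rightarrow> nat)" where
  "cons_inf u w = (\<lambda>k. if k < length u then u ! k else w (k - length u))"

definition has_prefix :: "(nat \<Rightarrow> nat) \<Rightarrow> nat list \<Rightarrow> bool" where
  "has_prefix w u \<longleftrightarrow> (\<forall>k<length u. w k = u ! k)"

definition act_inf :: "(nat list \<Rightarrow> nat list) \<Rightarrow> (nat \<Rightarrow> nat) \<Rightarrow> (nat \<Rightarrow> nat)" where
  "act_inf g w = (\<lambda>n. g (map w [0..<Suc n]) ! n)"

definition complete_rooted_subtree :: "nat \<Rightarrow> nat list set \<Rightarrow> bool" where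
  "complete_rooted_subtree d T \<longleftrightarrow> finite T \<and> T \<subseteq> words d \<and> [] \<in> T
     \<and> (\<forall>u x. u @ [x] \<in> T \<longrightarrow> u \<in> T)
     \<and> (\<forall>u x y. u @ [x] \<in> T \<longrightarrow> y < d \<longrightarrow> u @ [y] \<in> T)"

definition leaves :: "nat list set \<Rightarrow> nat list set" where
  "leaves T = {u \<in> T. \<forall>x. u @ [x] \<notin> T}"

(* leaves in lexicographic order (List_Lexorder) *)
definition leaf_list :: "nat list set \<Rightarrow> nat list list" where
  "leaf_list T = sorted_list_of_set (leaves T)"

(* [T_-, sigma(g_0,...,g_{n-1}), T_+] : v_i w |-> u_{sigma i} g_i(w)  (indices 0..n-1),
   identity outside X^omega *)
definition tree_pair_map :: "nat \<Rightarrow> nat list set \<Rightarrow> (nat \<Rightarrow> nat) \<Rightarrow> (nat \<Rightarrow> nat list \<Rightarrow> nat list)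
    \<Rightarrow> nat list set \<Rightarrow> (nat \<Rightarrow> nat) \<Rightarrow> (nat \<Rightarrow> nat)" where
  "tree_pair_map d Tm \<sigma> gs Tp w =
     (if w \<in> inf_words d then
        (let us = leaf_list Tm; vs = leaf_list Tp;
             i = (THE i. i < length vs \<and> has_prefix w (vs ! i))
         in cons_inf (us ! \<sigma> i) (act_inf (gs i) (\<lambda>k. w (k + length (vs ! i)))))
      else w)"

definition V_set :: "nat \<Rightarrow> (nat list \<Rightarrow> nat list) set \<Rightarrow> ((nat \<Rightarrow> nat) \<Rightarrow> (nat \<Rightarrow> nat)) set" where
  "V_set d G = {tree_pair_map d Tm \<sigma> gs Tp | Tm Tp \<sigma> gs.
      complete_rooted_subtree d Tm \<and> complete_rooted_subtree d Tp
      \<and> card (leaves Tm) = card (leaves Tp)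
      \<and> bij_betw \<sigma> {..<card (leaves Tp)} {..<card (leaves Tp)}
      \<and> (\<forall>i<card (leaves Tp). gs i \<in> G)}"

definition V_group :: "nat \<Rightarrow> (nat list \<Rightarrow> nat list) set \<Rightarrow> ((nat \<Rightarrow> nat) \<Rightarrow> (nat \<Rightarrow> nat)) monoid" where
  "V_group d G = \<lparr>carrier = V_set d G, monoid.mult = (\<circ>), one = id\<rparr>"

definition finite_abelianization :: "('a, 'b) monoid_scheme \<Rightarrow> bool" where
  "finite_abelianization A \<longleftrightarrow> finite (carrier (A Mod derived A (carrier A)))"

end

theory Submission
  imports Defs "HOL-Library.Sublist"
begin

text \<open>
  Write \<open>\<pi>\<close> for the quotient map to the abelianization. Up to finitely many exceptions all
  swaps of two disjoint cones are conjugate, and the element acting as \<open>g \<in> G\<close> on a proper cone and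
  trivially elsewhere has a class \<open>\<phi> g\<close> independent of the cone. Swaps and such elements generate
  \<open>V\<^sub>d(G)\<close>, so the abelianization is generated by finitely many involutions and the \<open>\<phi> s\<close> for
  generators \<open>s\<close> of \<open>G\<close>. Splitting a cone into its \<open>d\<close> children gives \<open>\<phi> g = t + \<Sum>\<^sub>x \<phi> (g\<^sub>x)\<close>, where \<open>t\<close> is the
  class of a permutation of cones, hence torsion. As \<open>G\<close> is coarsely diagonal, each \<open>\<phi> (g\<^sub>x)\<close> differs from
  \<open>\<phi> g\<close> by torsion, so \<open>(d - 1) \<phi> g\<close> is torsion. A finitely generated abelian torsion group is finite.
\<close>

subsection \<open>Words\<close>

text \<open>Conjugation can replace one cone of a swap only if a third cone is disjoint from both.
  Two one-letter cones may leave no room for it (for d = 2 they fill the whole space), so the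
  one-letter pairs are set aside, for every d, as the finitely many exceptions. For the same reason
  \<open>\<phi>\<close> uses proper cones: nothing is disjoint from the root cone.

  The torsion of t needs no computation. A map that permutes cones without labels lies in every
  subgroup that contains the swaps, in particular in the preimage of the torsion subgroup. The
  generation results are therefore stated for an arbitrary subgroup; the preimage of a finite
  subgroup is the second instance.

  Membership in the group is recast as a condition on all cones of one level, since levels compose
  easily, whereas tree pairs would need common refinements. The relation for \<open>\<phi> g\<close>
  is obtained by undoing g: the inverses of its sections, placed on the children of a cone, cancel
  its labels. The factor d - 1 is positive because d is at least 2.\<close>

lemma Nil_in_words [simp]: "[] \<in> words d"
  by (simp add: words_def)

lemma append_in_words [simp]: "u @ v \<in> words d \<longleftrightarrow> u \<in> words d \<and> v \<in> words d"
  by (auto simp: words_def)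

lemma Cons_in_words [simp]: "x # v \<in> words d \<longleftrightarrow> x < d \<and> v \<in> words d"
  by (auto simp: words_def)

lemma prefix_in_words: "prefix u v \<Longrightarrow> v \<in> words d \<Longrightarrow> u \<in> words d"
  by (auto simp: prefix_def)

lemma cons_inf_Nil [simp]: "cons_inf [] w = w"
  by (simp add: cons_inf_def)

lemma cons_inf_append [simp]: "cons_inf (u @ v) w = cons_inf u (cons_inf v w)"
  by (auto simp: cons_inf_def nth_append fun_eq_iff)

lemma cons_inf_in_inf_words [simp]:
  "cons_inf u w \<in> inf_words d \<longleftrightarrow> u \<in> words d \<and> w \<in> inf_words d"
proof
  assume *: "cons_inf u w \<in> inf_words d"
  have "u ! k < d" if "k < length u" for k
    using * that by (auto simp: inf_words_def cons_inf_def dest: spec[of _ k])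
  moreover have "w k < d" for k
    using * by (auto simp: inf_words_def cons_inf_def dest: spec[of _ "k + length u"])
  ultimately show "u \<in> words d \<and> w \<in> inf_words d"
    by (auto simp: words_def inf_words_def in_set_conv_nth)
next
  assume "u \<in> words d \<and> w \<in> inf_words d"
  then show "cons_inf u w \<in> inf_words d"
    by (auto simp: words_def inf_words_def cons_inf_def subset_iff)
qed

lemma shift_cons_inf [simp]: "(\<lambda>k. cons_inf u w (k + length u)) = w"
  by (simp add: cons_inf_def)

lemma cons_inf_take_shift: "cons_inf (map w [0..<n]) (\<lambda>k. w (k + n)) = w"
  by (auto simp: cons_inf_def fun_eq_iff)

lemma map_in_words: "w \<in> inf_words d \<Longrightarrow> map w [0..<n] \<in> words d"
  by (auto simp: words_def inf_words_def)

lemma shift_in_inf_words: "w \<in> inf_words d \<Longrightarrow> (\<lambda>k. w (k + n)) \<in> inf_words d"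
  by (auto simp: inf_words_def)

lemma take_cons_inf [simp]: "map (cons_inf u w) [0..<length u] = u"
  by (rule nth_equalityI) (auto simp: cons_inf_def)

lemma has_prefix_cons_inf [simp]: "has_prefix (cons_inf u w) u"
  by (simp add: has_prefix_def cons_inf_def)

lemma has_prefixE:
  assumes "has_prefix w u"
  obtains x where "w = cons_inf u x"
proof
  show "w = cons_inf u (\<lambda>k. w (k + length u))"
    using assms by (auto simp: has_prefix_def cons_inf_def fun_eq_iff)
qed

lemma has_prefixE_words:
  assumes "has_prefix w u" "w \<in> inf_words d"
  obtains x where "w = cons_inf u x" "u \<in> words d" "x \<in> inf_words d"
  by (metis assms cons_inf_in_inf_words has_prefixE)

lemma has_prefix_mono: "has_prefix w v \<Longrightarrow> prefix u v \<Longrightarrow> has_prefix w u"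
  by (auto simp: has_prefix_def prefix_def nth_append)

lemma has_prefix_linear:
  assumes "has_prefix w u" "has_prefix w v" "length u \<le> length v"
  shows "prefix u v"
proof -
  have "u = take (length u) v"
    using assms by (auto simp: has_prefix_def list_eq_iff_nth_eq)
  then show ?thesis by (metis take_is_prefix)
qed

lemma parallel_not_has_prefix: "parallel u v \<Longrightarrow> has_prefix w u \<Longrightarrow> \<not> has_prefix w v"
  by (meson has_prefix_linear nle_le parallelE)

lemma parallel_cons_inf [simp]: "parallel u v \<Longrightarrow> \<not> has_prefix (cons_inf u w) v"
  by (meson has_prefix_cons_inf parallel_not_has_prefix)

lemma parallel_cons_inf' [simp]: "parallel v u \<Longrightarrow> \<not> has_prefix (cons_inf u w) v"
  by (meson parallel_commute parallel_cons_inf)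

lemma cons_inf_inject [simp]: "cons_inf u w = cons_inf u x \<longleftrightarrow> w = x"
  by (metis shift_cons_inf)

lemma inf_words_nonempty: "0 < d \<Longrightarrow> (\<lambda>_. 0) \<in> inf_words d"
  by (simp add: inf_words_def)

subsection \<open>Tree automorphisms\<close>

lemma tree_aut_words: "is_tree_aut d f \<Longrightarrow> u \<in> words d \<Longrightarrow> f u \<in> words d"
  unfolding is_tree_aut_def bij_betw_def by blast

lemma tree_aut_words_iff: "is_tree_aut d f \<Longrightarrow> f u \<in> words d \<longleftrightarrow> u \<in> words d"
  unfolding is_tree_aut_def bij_betw_def by force

lemma tree_aut_inj: "is_tree_aut d f \<Longrightarrow> u \<in> words d \<Longrightarrow> v \<in> words d \<Longrightarrow> f u = f v \<Longrightarrow> u = v"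
  unfolding is_tree_aut_def bij_betw_def inj_on_def by blast

lemma tree_aut_off: "is_tree_aut d f \<Longrightarrow> w \<notin> words d \<Longrightarrow> f w = w"
  by (simp add: is_tree_aut_def)

lemma tree_aut_adj:
  "is_tree_aut d f \<Longrightarrow> u \<in> words d \<Longrightarrow> v \<in> words d \<Longrightarrow> tree_adj d (f u) (f v) \<longleftrightarrow> tree_adj d u v"
  unfolding is_tree_aut_def by blast

text \<open>Adjacency alone would allow a child to be sent to the parent of the image. Injectivity
  excludes this, because by induction that parent is already the image of \<open>u\<close>.\<close>

lemma tree_aut_snoc:
  assumes f: "is_tree_aut d f"
  shows "u @ [x] \<in> words d \<Longrightarrow> \<exists>y. f (u @ [x]) = f u @ [y]"
proof (induction u arbitrary: x rule: rev_induct)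
  case Nil
  then have "tree_adj d [] [x]"
    by (simp add: tree_adj_def)
  then have "tree_adj d (f []) (f [x])"
    using Nil by (simp add: tree_aut_adj[OF f])
  moreover have "f [] = []" using f by (simp add: is_tree_aut_def)
  ultimately show ?case by (auto simp: tree_adj_def)
next
  case (snoc z u)
  have "tree_adj d (u @ [z]) (u @ [z, x])"
    using snoc.prems by (auto simp: tree_adj_def)
  then have "tree_adj d (f (u @ [z])) (f (u @ [z, x]))"
    using snoc.prems by (simp add: tree_aut_adj[OF f])
  moreover obtain y where y: "f (u @ [z]) = f u @ [y]"
    using snoc by auto
  moreover have "f (u @ [z, x]) \<noteq> f u"
    using tree_aut_inj[OF f, of "u @ [z, x]" u] snoc.prems by auto
  ultimately show ?case
    by (auto simp: tree_adj_def)
qed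

lemma tree_aut_append_ex:
  assumes f: "is_tree_aut d f" and "u \<in> words d"
  shows "v \<in> words d \<Longrightarrow> \<exists>z. f (u @ v) = f u @ z \<and> length z = length v"
proof (induction v rule: rev_induct)
  case (snoc x v)
  then obtain z where "f (u @ v) = f u @ z" "length z = length v" by auto
  moreover obtain y where "f (u @ v @ [x]) = f (u @ v) @ [y]"
    using tree_aut_snoc[OF f, of "u @ v" x] snoc.prems assms(2) by auto
  ultimately show ?case by auto
qed simp

lemma tree_aut_length: "is_tree_aut d f \<Longrightarrow> length (f u) = length u"
  using tree_aut_append_ex[of d f "[]" u] by (cases "u \<in> words d") (auto simp: tree_aut_off, simp add: is_tree_aut_def)

text \<open>The \<open>drop\<close> in \<open>tsection\<close> removes exactly \<open>f u\<close>,
  since \<open>f\<close> preserves prefixes and lengths. Hence \<open>tsection\<close> is the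
  section prescribed by the wreath recursion.\<close>

lemma tree_aut_append:
  assumes f: "is_tree_aut d f" and "u \<in> words d" "v \<in> words d"
  shows "f (u @ v) = f u @ tsection d f u v"
  using tree_aut_append_ex[OF assms] assms by (auto simp: tsection_def tree_aut_length[OF f])

lemma tree_aut_id: "is_tree_aut d id"
  by (simp add: is_tree_aut_def)

lemma tree_aut_comp:
  assumes f: "is_tree_aut d f" and g: "is_tree_aut d g"
  shows "is_tree_aut d (f \<circ> g)"
  unfolding is_tree_aut_def
proof (intro conjI ballI allI impI)
  show "bij_betw (f \<circ> g) (words d) (words d)"
    using f g by (auto intro: bij_betw_trans simp: is_tree_aut_def)
  show "(f \<circ> g) [] = []"
    using f g by (simp add: is_tree_aut_def)
qed (simp_all add: tree_aut_adj[OF f] tree_aut_adj[OF g] tree_aut_words[OF g] tree_aut_off[OF f] tree_aut_off[OF g])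

lemma tree_aut_inv_ex:
  assumes f: "is_tree_aut d f"
  shows "\<exists>g. is_tree_aut d g \<and> g \<circ> f = id"
proof -
  define g where "g = (\<lambda>w. if w \<in> words d then inv_into (words d) f w else w)"
  have bij: "bij_betw f (words d) (words d)" using f by (simp add: is_tree_aut_def)
  have gf: "g (f w) = w" for w
    using bij_betw_inv_into_left[OF bij] tree_aut_off[OF f]
    by (cases "w \<in> words d") (auto simp: g_def tree_aut_words_iff[OF f])
  have fg: "f (g w) = w" for w
    using bij_betw_inv_into_right[OF bij] tree_aut_off[OF f] by (cases "w \<in> words d") (auto simp: g_def)
  have gw: "g w \<in> words d" if "w \<in> words d" for w
    using fg tree_aut_words_iff[OF f] that by metis
  have "is_tree_aut d g"
    unfolding is_tree_aut_def
  proof (intro conjI ballI allI impI)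
    show "bij_betw g (words d) (words d)"
      by (rule bij_betw_byWitness[where f' = f]) (use gf fg gw tree_aut_words[OF f] in auto)
    show "g [] = []" using gf[of "[]"] f by (simp add: is_tree_aut_def)
    show "tree_adj d u v \<longleftrightarrow> tree_adj d (g u) (g v)" if "u \<in> words d" "v \<in> words d" for u v
      using tree_aut_adj[OF f gw[OF that(1)] gw[OF that(2)]] fg by simp
  qed (simp add: g_def)
  then show ?thesis using gf by (auto simp: fun_eq_iff)
qed

lemma aut_group_simps [simp]:
  "carrier (aut_group d) = {f. is_tree_aut d f}"
  "monoid.mult (aut_group d) = (\<circ>)"
  "one (aut_group d) = id"
  by (simp_all add: aut_group_def)

lemma group_aut_group: "group (aut_group d)"
proof (rule groupI)
  fix f assume "f \<in> carrier (aut_group d)"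
  then show "\<exists>g\<in>carrier (aut_group d). g \<otimes>\<^bsub>aut_group d\<^esub> f = \<one>\<^bsub>aut_group d\<^esub>"
    using tree_aut_inv_ex[of d f] by simp
qed (auto simp: tree_aut_id tree_aut_comp o_assoc)

section \<open>The action of tree automorphisms on infinite words\<close>

lemma act_inf_id [simp]: "act_inf id w = w"
  by (simp add: act_inf_def fun_eq_iff nth_append)

text \<open>\<open>act_inf\<close> reads every letter off a different finite image. Compatibility
  with prefixes makes these letters fit together, so \<open>act_inf f\<close> really is the
  extension of \<open>f\<close> to the boundary of the tree.\<close>

lemma take_act_inf:
  assumes f: "is_tree_aut d f" and w: "w \<in> inf_words d"
  shows "map (act_inf f w) [0..<n] = f (map w [0..<n])"
proof (rule nth_equalityI)
  fix k assume "k < length (map (act_inf f w) [0..<n])"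
  then have k: "k < n" by simp
  then have "[0..<n] = [0..<Suc k] @ [Suc k..<n]"
    by (metis Suc_leI le_add_diff_inverse upt_add_eq_append zero_le)
  then have "map w [0..<n] = map w [0..<Suc k] @ map w [Suc k..<n]"
    by (metis map_append)
  moreover have "map w [0..<Suc k] \<in> words d" "map w [Suc k..<n] \<in> words d"
    using w by (auto simp: words_def inf_words_def)
  ultimately have "f (map w [0..<n])
      = f (map w [0..<Suc k]) @ tsection d f (map w [0..<Suc k]) (map w [Suc k..<n])"
    using tree_aut_append[OF f] by metis
  then show "map (act_inf f w) [0..<n] ! k = f (map w [0..<n]) ! k"
    using k by (simp add: act_inf_def nth_append tree_aut_length[OF f] del: upt_Suc)
qed (simp add: tree_aut_length[OF f])

lemma act_inf_in_inf_words:
  assumes f: "is_tree_aut d f" and w: "w \<in> inf_words d"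
  shows "act_inf f w \<in> inf_words d"
proof -
  have "act_inf f w n < d" for n
  proof -
    have "map (act_inf f w) [0..<Suc n] \<in> words d"
      unfolding take_act_inf[OF assms] by (intro tree_aut_words[OF f] map_in_words[OF w])
    then show ?thesis by simp
  qed
  then show ?thesis by (simp add: inf_words_def)
qed

lemma act_inf_comp:
  assumes "is_tree_aut d g" "w \<in> inf_words d"
  shows "act_inf f (act_inf g w) = act_inf (f \<circ> g) w"
  by (rule ext, subst act_inf_def, subst take_act_inf[OF assms]) (simp add: act_inf_def)

lemma act_inf_cons_inf:
  assumes f: "is_tree_aut d f" and u: "u \<in> words d" and w: "w \<in> inf_words d"
  shows "act_inf f (cons_inf u w) = cons_inf (f u) (act_inf (tsection d f u) w)"
proof
  fix k
  have uw: "cons_inf u w \<in> inf_words d" using u w by simp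
  show "act_inf f (cons_inf u w) k = cons_inf (f u) (act_inf (tsection d f u) w) k"
  proof (cases "k < length u")
    case True
    have "act_inf f (cons_inf u w) k = map (act_inf f (cons_inf u w)) [0..<length u] ! k"
      using True by simp
    also have "\<dots> = f u ! k"
      unfolding take_act_inf[OF f uw] by simp
    finally show ?thesis using True by (simp add: cons_inf_def tree_aut_length[OF f])
  next
    case False
    then obtain j where k: "k = length u + j" by (metis le_add_diff_inverse not_less)
    have "map (cons_inf u w) [0..<Suc k] = u @ map w [0..<Suc j]"
      by (rule nth_equalityI) (auto simp: k cons_inf_def nth_append simp del: upt_Suc)
    then have "f (map (cons_inf u w) [0..<Suc k]) = f u @ tsection d f u (map w [0..<Suc j])"
      using tree_aut_append[OF f u map_in_words[OF w]] by metis
    then show ?thesis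
      by (simp add: act_inf_def cons_inf_def k nth_append tree_aut_length[OF f] del: upt_Suc)
  qed
qed

subsection \<open>Partitions into cones\<close>

text \<open>For \<open>0 < d\<close> these are exactly the leaf sets of complete rooted subtrees.
  Describing them through infinite words dispenses with the inner vertices and with the order of the
  leaves.\<close>

definition cone_partition :: "nat \<Rightarrow> nat list set \<Rightarrow> bool" where
  "cone_partition d P \<longleftrightarrow> finite P \<and> P \<subseteq> words d \<and> (\<forall>w\<in>inf_words d. \<exists>!p. p \<in> P \<and> has_prefix w p)"

lemma cone_partition_finite: "cone_partition d P \<Longrightarrow> finite P"
  by (simp add: cone_partition_def)

lemma cone_partition_words: "cone_partition d P \<Longrightarrow> p \<in> P \<Longrightarrow> p \<in> words d"
  by (auto simp: cone_partition_def)

lemma cone_partition_unique: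
  "cone_partition d P \<Longrightarrow> w \<in> inf_words d \<Longrightarrow> p \<in> P \<Longrightarrow> q \<in> P \<Longrightarrow>
    has_prefix w p \<Longrightarrow> has_prefix w q \<Longrightarrow> p = q"
  by (auto simp: cone_partition_def)

lemma cone_partitionE:
  assumes "cone_partition d P" "w \<in> inf_words d"
  obtains p x where "p \<in> P" "p \<in> words d" "x \<in> inf_words d" "w = cons_inf p x"
proof -
  obtain p where "p \<in> P" "has_prefix w p"
    using assms unfolding cone_partition_def by blast
  then show ?thesis
    using assms(2) by (auto elim!: has_prefixE_words[OF _ assms(2)] intro: that)
qed

lemma cone_partition_prefix_eq:
  assumes "cone_partition d P" "0 < d" "p \<in> P" "q \<in> P" "prefix p q"
  shows "p = q"
  using cone_partition_unique[OF assms(1), of "cons_inf q (\<lambda>_. 0)" p q] assms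
    has_prefix_mono[of _ q p] cone_partition_words[OF assms(1)] inf_words_nonempty by simp

lemma cone_partition_parallel:
  assumes "cone_partition d P" "0 < d" "p \<in> P" "q \<in> P" "p \<noteq> q"
  shows "parallel p q"
  using assms cone_partition_prefix_eq by (metis parallelI)

lemma cone_partition_comparable:
  assumes "cone_partition d P" "0 < d" "u \<in> words d"
  shows "\<exists>p\<in>P. prefix p u \<or> prefix u p"
proof -
  have "cons_inf u (\<lambda>_. 0) \<in> inf_words d"
    using assms inf_words_nonempty by simp
  then obtain p where "p \<in> P" "has_prefix (cons_inf u (\<lambda>_. 0)) p"
    using assms(1) unfolding cone_partition_def by blast
  then show ?thesis
    by (meson has_prefix_cons_inf has_prefix_linear nle_le)
qed

lemma cone_partition_level: "cone_partition d {v \<in> words d. length v = n}"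
proof -
  have "finite {v \<in> words d. length v = n}"
    using finite_lists_length_eq[of "{..<d}" n] by (simp add: words_def)
  moreover have "\<exists>!p. p \<in> {v \<in> words d. length v = n} \<and> has_prefix w p" if w: "w \<in> inf_words d" for w
  proof
    show "map w [0..<n] \<in> {v \<in> words d. length v = n} \<and> has_prefix w (map w [0..<n])"
      using map_in_words[OF w] by (simp add: has_prefix_def)
  next
    fix p assume "p \<in> {v \<in> words d. length v = n} \<and> has_prefix w p"
    then show "p = map w [0..<n]"
      by (auto simp: has_prefix_def intro: nth_equalityI)
  qed
  ultimately show ?thesis by (auto simp: cone_partition_def)
qed

lemma prefix_neq_snoc: "prefix u v \<Longrightarrow> u \<noteq> v \<Longrightarrow> \<exists>x. prefix (u @ [x]) v"
proof -
  assume "prefix u v" "u \<noteq> v"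
  then obtain x w where "v = u @ x # w" by (metis append_Nil2 list.exhaust prefixE)
  then show ?thesis by auto
qed

lemma complete_rooted_prefix_closed:
  assumes "complete_rooted_subtree d T"
  shows "u @ v \<in> T \<Longrightarrow> u \<in> T"
proof (induction v rule: rev_induct)
  case (snoc x v)
  then show ?case using assms unfolding complete_rooted_subtree_def by (metis append_assoc)
qed simp

text \<open>An infinite word must leave a finite tree. Its last prefix inside is a leaf: by
  completeness, a single child in \<open>T\<close> would bring in the child that the word follows.
  Prefix closure prevents a leaf from being a proper prefix of another.\<close>

lemma cone_partition_leaves:
  assumes T: "complete_rooted_subtree d T"
  shows "cone_partition d (leaves T)"
proof -
  have fin: "finite T" and Tw: "T \<subseteq> words d" and root: "[] \<in> T"
    and compl: "\<And>u x y. u @ [x] \<in> T \<Longrightarrow> y < d \<Longrightarrow> u @ [y] \<in> T"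
    using T by (auto simp: complete_rooted_subtree_def)
  have "\<exists>!p. p \<in> leaves T \<and> has_prefix w p" if w: "w \<in> inf_words d" for w
  proof -
    let ?pre = "\<lambda>n. map w [0..<n]"
    have "\<exists>n. ?pre n \<notin> T"
    proof (rule ccontr)
      assume "\<nexists>n. ?pre n \<notin> T"
      then have "range ?pre \<subseteq> T" by auto
      then have "finite (range ?pre)" using fin finite_subset by blast
      moreover have "inj ?pre" by (rule injI) (metis length_map length_upt minus_nat.diff_0)
      ultimately show False using finite_imageD infinite_UNIV_nat by blast
    qed
    then obtain n where n: "?pre (Suc n) \<notin> T" "?pre n \<in> T"
      using exists_least_lemma[of "\<lambda>n. ?pre n \<notin> T"] root by (auto simp del: upt_Suc)
    have "?pre n @ [x] \<notin> T" for x
      using compl[of "?pre n" x "w n"] n w by (auto simp: inf_words_def)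
    then have "?pre n \<in> leaves T" using n by (auto simp: leaves_def)
    moreover have "has_prefix w (?pre n)" by (simp add: has_prefix_def)
    moreover have "p = q" if p: "p \<in> leaves T" and q: "q \<in> leaves T" and pq: "prefix p q" for p q
    proof (rule ccontr)
      assume "p \<noteq> q"
      then obtain x v where "q = (p @ [x]) @ v"
        using pq prefix_neq_snoc by (metis prefixE)
      then have "p @ [x] \<in> T"
        using complete_rooted_prefix_closed[OF T] q by (auto simp: leaves_def)
      then show False using p by (auto simp: leaves_def)
    qed
    ultimately show ?thesis by (metis has_prefix_linear nle_le)
  qed
  then show ?thesis
    using fin Tw by (auto simp: cone_partition_def leaves_def)
qed

text \<open>Completeness is the point with content. The sibling \<open>u @ [y]\<close> is comparable
  with some \<open>q\<close> in \<open>P\<close>, and \<open>q\<close> cannot be a prefix of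
  \<open>u\<close>, since it would then be a proper prefix of the member of \<open>P\<close> that
  extends \<open>u @ [x]\<close>.\<close>

lemma complete_rooted_of_cone_partition:
  assumes P: "cone_partition d P" and d: "0 < d"
  defines "T \<equiv> {u. \<exists>p\<in>P. prefix u p}"
  shows "complete_rooted_subtree d T" "leaves T = P"
proof -
  have T: "T = (\<Union>p\<in>P. set (prefixes p))" by (auto simp: T_def)
  show "complete_rooted_subtree d T"
    unfolding complete_rooted_subtree_def
  proof (intro conjI allI impI)
    show "finite T" using cone_partition_finite[OF P] by (simp add: T)
    show "T \<subseteq> words d"
      using cone_partition_words[OF P] prefix_in_words by (auto simp: T_def)
    show "[] \<in> T"
      using cone_partition_comparable[OF P d, of "[]"] by (auto simp: T_def)
    show "u \<in> T" if "u @ [x] \<in> T" for u x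
      using that by (auto simp: T_def dest: append_prefixD)
    show "u @ [y] \<in> T" if ux: "u @ [x] \<in> T" and y: "y < d" for u x y
    proof -
      obtain p where p: "p \<in> P" "prefix (u @ [x]) p" using ux by (auto simp: T_def)
      then have "u \<in> words d" using cone_partition_words[OF P] prefix_in_words by fastforce
      then obtain q where q: "q \<in> P" "prefix q (u @ [y]) \<or> prefix (u @ [y]) q"
        using cone_partition_comparable[OF P d, of "u @ [y]"] y by auto
      have "\<not> prefix q u"
      proof
        assume qu: "prefix q u"
        then have "q = p"
          using cone_partition_prefix_eq[OF P d q(1) p(1)] p(2)
          by (meson append_prefixD prefix_order.trans)
        then show False using qu p(2) by (auto dest!: prefix_length_le)
      qed
      then show ?thesis using q by (auto simp: T_def)
    qed
  qed
  show "leaves T = P"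
  proof (intro equalityI subsetI)
    fix u assume "u \<in> leaves T"
    then obtain p where p: "p \<in> P" "prefix u p" and "\<And>x. u @ [x] \<notin> T"
      by (auto simp: leaves_def T_def)
    then have "u = p"
      using prefix_neq_snoc[OF p(2)] by (auto simp: T_def)
    then show "u \<in> P" using p by simp
  next
    fix p assume p: "p \<in> P"
    have "p @ [x] \<notin> T" for x
    proof
      assume "p @ [x] \<in> T"
      then obtain q where q: "q \<in> P" "prefix (p @ [x]) q" by (auto simp: T_def)
      then have "p = q" using cone_partition_prefix_eq[OF P d p] append_prefixD by blast
      then show False using q by simp
    qed
    then show "p \<in> leaves T" using p by (auto simp: leaves_def T_def)
  qed
qed

subsection \<open>Tables\<close>

definition similar :: "nat \<Rightarrow> ((nat \<Rightarrow> nat) \<Rightarrow> (nat \<Rightarrow> nat)) \<Rightarrow> nat list \<Rightarrow> nat list \<Rightarrow> (nat list \<Rightarrow> nat list) \<Rightarrow> bool"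
  where "similar d f v u g \<longleftrightarrow> (\<forall>w\<in>inf_words d. f (cons_inf v w) = cons_inf u (act_inf g w))"

text \<open>A tree pair freed from numbering: \<open>\<beta>\<close> absorbs the permutation
  together with both lexicographic enumerations of leaves, and \<open>\<gamma>\<close> attaches each
  label to the leaf of the domain tree itself.\<close>

definition table :: "nat \<Rightarrow> (nat list \<Rightarrow> nat list) set \<Rightarrow> nat list set \<Rightarrow> nat list set
    \<Rightarrow> (nat list \<Rightarrow> nat list) \<Rightarrow> (nat list \<Rightarrow> nat list \<Rightarrow> nat list) \<Rightarrow> ((nat \<Rightarrow> nat) \<Rightarrow> (nat \<Rightarrow> nat)) \<Rightarrow> bool"
  where "table d G P P' \<beta> \<gamma> f \<longleftrightarrow> cone_partition d P \<and> cone_partition d P' \<and> bij_betw \<beta> P P'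
    \<and> (\<forall>p\<in>P. \<gamma> p \<in> G \<and> similar d f p (\<beta> p) (\<gamma> p)) \<and> (\<forall>w. w \<notin> inf_words d \<longrightarrow> f w = w)"

lemma tree_pair_map_leaf:
  assumes Tp: "complete_rooted_subtree d Tp" and i: "i < length (leaf_list Tp)" and w: "w \<in> inf_words d"
  shows "tree_pair_map d Tm \<sigma> gs Tp (cons_inf (leaf_list Tp ! i) w)
    = cons_inf (leaf_list Tm ! \<sigma> i) (act_inf (gs i) w)"
proof -
  let ?vs = "leaf_list Tp" and ?w = "cons_inf (leaf_list Tp ! i) w"
  have P: "cone_partition d (leaves Tp)" using cone_partition_leaves[OF Tp] .
  have set: "set ?vs = leaves Tp" "distinct ?vs"
    using cone_partition_finite[OF P] by (simp_all add: leaf_list_def)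
  then have w': "?w \<in> inf_words d"
    using cone_partition_words[OF P] i w nth_mem by fastforce
  have "(THE j. j < length ?vs \<and> has_prefix ?w (?vs ! j)) = i"
  proof (rule the_equality)
    fix j assume j: "j < length ?vs \<and> has_prefix ?w (?vs ! j)"
    then have "?vs ! j = ?vs ! i"
      using cone_partition_unique[OF P w'] i set nth_mem by (metis has_prefix_cons_inf)
    then show "j = i" using set(2) i j by (simp add: nth_eq_iff_index_eq)
  qed (use i in simp)
  then show ?thesis using w' by (simp add: tree_pair_map_def Let_def)
qed

text \<open>Composing with the enumerations of the leaves turns \<open>\<sigma>\<close> into
  \<open>\<beta>\<close> and back. Trees are recovered from partitions as their prefix
  closures.\<close>

lemma V_set_iff_table:
  assumes d: "0 < d"
  shows "f \<in> V_set d G \<longleftrightarrow> (\<exists>P P' \<beta> \<gamma>. table d G P P' \<beta> \<gamma> f)"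
proof
  assume "f \<in> V_set d G"
  then obtain Tm Tp \<sigma> gs where f: "f = tree_pair_map d Tm \<sigma> gs Tp"
    and T: "complete_rooted_subtree d Tm" "complete_rooted_subtree d Tp"
    and card: "card (leaves Tm) = card (leaves Tp)"
    and \<sigma>: "bij_betw \<sigma> {..<card (leaves Tp)} {..<card (leaves Tp)}"
    and gs: "\<forall>i<card (leaves Tp). gs i \<in> G"
    by (auto simp: V_set_def)
  note P = cone_partition_leaves[OF T(2)] and P' = cone_partition_leaves[OF T(1)]
  let ?n = "card (leaves Tp)"
  have len: "length (leaf_list Tp) = ?n" "length (leaf_list Tm) = ?n"
    using card by (simp_all add: leaf_list_def)
  have vs: "bij_betw ((!) (leaf_list Tp)) {..<?n} (leaves Tp)"
    using cone_partition_finite[OF P] by (intro bij_betw_nth) (auto simp: leaf_list_def)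
  have us: "bij_betw ((!) (leaf_list Tm)) {..<?n} (leaves Tm)"
    using cone_partition_finite[OF P'] card by (intro bij_betw_nth) (auto simp: leaf_list_def)
  \<comment> \<open>\<open>k\<close> returns the number of a leaf of the domain tree; in the
    converse direction below, the same name numbers the leaves of the target tree.\<close>
  define k where "k = the_inv_into {..<?n} ((!) (leaf_list Tp))"
  have k: "bij_betw k (leaves Tp) {..<?n}"
    unfolding k_def using vs by (rule bij_betw_the_inv_into)
  have "table d G (leaves Tp) (leaves Tm) ((!) (leaf_list Tm) \<circ> (\<sigma> \<circ> k)) (gs \<circ> k) f"
    unfolding table_def
  proof (intro conjI ballI allI impI P P')
    show "bij_betw ((!) (leaf_list Tm) \<circ> (\<sigma> \<circ> k)) (leaves Tp) (leaves Tm)"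
      using k \<sigma> us by (blast intro: bij_betw_trans)
    fix p assume p: "p \<in> leaves Tp"
    then have kp: "k p < ?n" using k by (auto simp: bij_betw_def)
    then show "(gs \<circ> k) p \<in> G" using gs by simp
    have "leaf_list Tp ! k p = p"
      unfolding k_def using vs p by (metis bij_betw_def f_the_inv_into_f)
    then show "similar d f p (((!) (leaf_list Tm) \<circ> (\<sigma> \<circ> k)) p) ((gs \<circ> k) p)"
      using tree_pair_map_leaf[OF T(2), of "k p" _ Tm \<sigma> gs] kp len f by (simp add: similar_def)
  next
    show "f w = w" if "w \<notin> inf_words d" for w
      using that by (simp add: f tree_pair_map_def)
  qed
  then show "\<exists>P P' \<beta> \<gamma>. table d G P P' \<beta> \<gamma> f" by blast
next
  assume "\<exists>P P' \<beta> \<gamma>. table d G P P' \<beta> \<gamma> f"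
  then obtain P P' \<beta> \<gamma> where P: "cone_partition d P" and P': "cone_partition d P'"
    and \<beta>: "bij_betw \<beta> P P'" and \<gamma>: "\<And>p. p \<in> P \<Longrightarrow> \<gamma> p \<in> G"
    and sim: "\<And>p. p \<in> P \<Longrightarrow> similar d f p (\<beta> p) (\<gamma> p)"
    and off: "\<And>w. w \<notin> inf_words d \<Longrightarrow> f w = w"
    unfolding table_def by blast
  define Tp where "Tp = {u. \<exists>p\<in>P. prefix u p}"
  define Tm where "Tm = {u. \<exists>p\<in>P'. prefix u p}"
  have Tp: "complete_rooted_subtree d Tp" "leaves Tp = P"
    unfolding Tp_def by (rule complete_rooted_of_cone_partition[OF P d])+
  have Tm: "complete_rooted_subtree d Tm" "leaves Tm = P'"
    unfolding Tm_def by (rule complete_rooted_of_cone_partition[OF P' d])+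
  let ?n = "card P"
  have card: "card P' = ?n" using \<beta> by (simp add: bij_betw_same_card)
  have vs: "bij_betw ((!) (leaf_list Tp)) {..<?n} P"
    using cone_partition_finite[OF P] Tp by (intro bij_betw_nth) (auto simp: leaf_list_def)
  have us: "bij_betw ((!) (leaf_list Tm)) {..<?n} P'"
    using cone_partition_finite[OF P'] card Tm by (intro bij_betw_nth) (auto simp: leaf_list_def)
  define k where "k = the_inv_into {..<?n} ((!) (leaf_list Tm))"
  have k: "bij_betw k P' {..<?n}"
    unfolding k_def using us by (rule bij_betw_the_inv_into)
  define \<sigma> where "\<sigma> = k \<circ> (\<beta> \<circ> (!) (leaf_list Tp))"
  define gs where "gs = \<gamma> \<circ> (!) (leaf_list Tp)"
  have \<sigma>: "bij_betw \<sigma> {..<?n} {..<?n}"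
    unfolding \<sigma>_def using k vs \<beta> by (blast intro: bij_betw_trans)
  have "f = tree_pair_map d Tm \<sigma> gs Tp"
  proof
    fix w
    show "f w = tree_pair_map d Tm \<sigma> gs Tp w"
    proof (cases "w \<in> inf_words d")
      case True
      then obtain p x where p: "p \<in> P" "x \<in> inf_words d" "w = cons_inf p x"
        using cone_partitionE[OF P] by metis
      then obtain i where i: "i < ?n" "p = leaf_list Tp ! i"
        using vs unfolding bij_betw_def by (metis imageE lessThan_iff)
      have "\<beta> p \<in> P'" using \<beta> p by (auto simp: bij_betw_def)
      then have "leaf_list Tm ! \<sigma> i = \<beta> p"
        unfolding \<sigma>_def k_def using us i by (simp add: bij_betw_def f_the_inv_into_f)
      moreover have "length (leaf_list Tp) = ?n" by (simp add: leaf_list_def Tp)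
      ultimately show ?thesis
        using tree_pair_map_leaf[OF Tp(1), of i x Tm \<sigma> gs] sim[OF p(1)] i p
        by (simp add: similar_def gs_def)
    qed (simp add: off tree_pair_map_def)
  qed
  moreover have "\<forall>i<?n. gs i \<in> G" using vs \<gamma> by (auto simp: gs_def bij_betw_def)
  ultimately show "f \<in> V_set d G"
    unfolding V_set_def using Tp Tm card \<sigma> by blast
qed

subsection \<open>The group structure\<close>

lemma take_in_words: "u \<in> words d \<Longrightarrow> take n u \<in> words d"
  using set_take_subset by (fastforce simp: words_def)

lemma drop_in_words: "u \<in> words d \<Longrightarrow> drop n u \<in> words d"
  using set_drop_subset by (fastforce simp: words_def)

section \<open>Self-similar groups and the action of their elements\<close>

locale self_similar_group =
  fixes d :: nat and G :: "(nat list \<Rightarrow> nat list) set"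
  assumes d_ge_2: "d \<ge> 2"
    and subgroup_G: "subgroup G (aut_group d)"
    and self_similar_G: "self_similar d G"
begin

lemma d_pos: "0 < d" using d_ge_2 by simp

lemma G_aut: "g \<in> G \<Longrightarrow> is_tree_aut d g"
  using subgroup.subset[OF subgroup_G] by auto

lemma G_id: "id \<in> G"
  using subgroup.one_closed[OF subgroup_G] by simp

lemma G_comp: "g \<in> G \<Longrightarrow> h \<in> G \<Longrightarrow> g \<circ> h \<in> G"
  using subgroup.m_closed[OF subgroup_G] by simp

lemma G_inv:
  assumes "g \<in> G"
  obtains h where "h \<in> G" "h \<circ> g = id" "g \<circ> h = id"
proof
  interpret A: group "aut_group d" by (rule group_aut_group)
  show "inv\<^bsub>aut_group d\<^esub> g \<in> G" using subgroup.m_inv_closed[OF subgroup_G assms] .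
  show "inv\<^bsub>aut_group d\<^esub> g \<circ> g = id" "g \<circ> inv\<^bsub>aut_group d\<^esub> g = id"
    using A.l_inv[of g] A.r_inv[of g] G_aut[OF assms] by simp_all
qed

lemma tsection_snoc:
  "u \<in> words d \<Longrightarrow> x < d \<Longrightarrow> tsection d f (u @ [x]) = tsection d (tsection d f u) [x]"
  by (auto simp: tsection_def fun_eq_iff add.commute)

lemma tsection_in_states: "u \<in> words d \<Longrightarrow> g \<in> G \<Longrightarrow> tsection d g u \<in> states d g"
proof (induction u rule: rev_induct)
  case Nil
  have "tsection d g [] = g"
    using tree_aut_off[OF G_aut[OF Nil(2)]] by (auto simp: tsection_def)
  then show ?case by (simp add: states.self)
next
  case (snoc x u)
  then show ?case by (simp add: tsection_snoc states.level1)
qed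

lemma G_tsection: "u \<in> words d \<Longrightarrow> g \<in> G \<Longrightarrow> tsection d g u \<in> G"
  using tsection_in_states self_similar_G unfolding self_similar_def by blast

lemma act_in: "g \<in> G \<Longrightarrow> w \<in> inf_words d \<Longrightarrow> act_inf g w \<in> inf_words d"
  by (rule act_inf_in_inf_words[OF G_aut])

lemma act_comp: "g \<in> G \<Longrightarrow> w \<in> inf_words d \<Longrightarrow> act_inf h (act_inf g w) = act_inf (h \<circ> g) w"
  by (rule act_inf_comp[OF G_aut])

lemma act_inj: "g \<in> G \<Longrightarrow> w \<in> inf_words d \<Longrightarrow> x \<in> inf_words d \<Longrightarrow> act_inf g w = act_inf g x \<Longrightarrow> w = x"
  by (metis G_inv act_comp act_inf_id)

lemma act_surj:
  assumes "g \<in> G" "w \<in> inf_words d"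
  obtains x where "x \<in> inf_words d" "act_inf g x = w"
  by (metis G_inv[OF assms(1)] act_comp act_in act_inf_id assms(2))

text \<open>This is the wreath recursion, used to pass to smaller cones. By
  \<open>G_tsection\<close> the new label stays in \<open>G\<close>.\<close>

lemma similar_append:
  assumes "similar d f v u g" "g \<in> G" "z \<in> words d"
  shows "similar d f (v @ z) (u @ g z) (tsection d g z)"
  using assms by (simp add: similar_def act_inf_cons_inf[OF G_aut])

section \<open>Tables and the level criterion\<close>

lemma table_bij:
  assumes "table d G P P' \<beta> \<gamma> f"
  shows "bij_betw f (inf_words d) (inf_words d)"
proof -
  have P: "cone_partition d P" and P': "cone_partition d P'"
    and \<beta>: "bij_betw \<beta> P P'" and \<gamma>: "\<And>p. p \<in> P \<Longrightarrow> \<gamma> p \<in> G"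
    and sim: "\<And>p. p \<in> P \<Longrightarrow> similar d f p (\<beta> p) (\<gamma> p)"
    using assms unfolding table_def by blast+
  have \<beta>P: "\<beta> p \<in> P'" if "p \<in> P" for p using \<beta> that by (auto simp: bij_betw_def)
  have into: "f w \<in> inf_words d" if w: "w \<in> inf_words d" for w
  proof -
    obtain p x where p: "p \<in> P" "x \<in> inf_words d" "w = cons_inf p x"
      using cone_partitionE[OF P w] by metis
    then have "f w = cons_inf (\<beta> p) (act_inf (\<gamma> p) x)"
      using sim[OF p(1)] by (simp add: similar_def)
    then show ?thesis
      using act_in[OF \<gamma>] p cone_partition_words[OF P' \<beta>P] by simp
  qed
  show ?thesis
  proof (rule bij_betw_imageI)
    show "inj_on f (inf_words d)"
    proof (rule inj_onI)
      fix w w' assume w: "w \<in> inf_words d" "w' \<in> inf_words d" and eq: "f w = f w'"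
      obtain p x where p: "p \<in> P" "x \<in> inf_words d" "w = cons_inf p x"
        using cone_partitionE[OF P w(1)] by metis
      obtain q y where q: "q \<in> P" "y \<in> inf_words d" "w' = cons_inf q y"
        using cone_partitionE[OF P w(2)] by metis
      have fw: "f w = cons_inf (\<beta> p) (act_inf (\<gamma> p) x)" "f w = cons_inf (\<beta> q) (act_inf (\<gamma> q) y)"
        using sim[OF p(1)] sim[OF q(1)] p q eq by (auto simp: similar_def)
      then have "\<beta> p = \<beta> q"
        using cone_partition_unique[OF P' into[OF w(1)] \<beta>P[OF p(1)] \<beta>P[OF q(1)]] has_prefix_cons_inf
        by metis
      then have "p = q" using \<beta> p q by (auto simp: bij_betw_def inj_on_def)
      then show "w = w'"
        using fw act_inj[OF \<gamma>[OF p(1)]] p q by simp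
    qed
    show "f ` inf_words d = inf_words d"
    proof (intro equalityI subsetI)
      fix w assume w: "w \<in> inf_words d"
      obtain q y where q: "q \<in> P'" "y \<in> inf_words d" "w = cons_inf q y"
        using cone_partitionE[OF P' w] by metis
      obtain p where p: "p \<in> P" "\<beta> p = q" using \<beta> q by (auto simp: bij_betw_def)
      obtain x where x: "x \<in> inf_words d" "act_inf (\<gamma> p) x = y"
        using act_surj[OF \<gamma>[OF p(1)] q(2)] by metis
      have "f (cons_inf p x) = w" using sim[OF p(1)] x p q by (simp add: similar_def)
      moreover have "cons_inf p x \<in> inf_words d"
        using p x cone_partition_words[OF P] by simp
      ultimately show "w \<in> f ` inf_words d" by blast
    qed (use into in blast)
  qed
qed

text \<open>No target partition has to be supplied. Each label acts surjectively on infinite words,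
  so each cone is mapped onto the whole cone of \<open>\<beta> v\<close>; bijectivity of
  \<open>f\<close> then makes these image cones disjoint and exhaustive.\<close>

lemma table_of_level:
  assumes bij: "bij_betw f (inf_words d) (inf_words d)"
    and off: "\<forall>w. w \<notin> inf_words d \<longrightarrow> f w = w"
    and ex: "\<And>v. v \<in> words d \<Longrightarrow> length v = n \<Longrightarrow> \<exists>u\<in>words d. \<exists>g\<in>G. similar d f v u g"
  shows "\<exists>P' \<beta> \<gamma>. table d G {v \<in> words d. length v = n} P' \<beta> \<gamma> f"
proof -
  have "\<forall>v\<in>{v \<in> words d. length v = n}.
      \<exists>ug. fst ug \<in> words d \<and> snd ug \<in> G \<and> similar d f v (fst ug) (snd ug)"
    using ex by force
  then obtain ug where ug: "\<forall>v\<in>{v \<in> words d. length v = n}.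
      fst (ug v) \<in> words d \<and> snd (ug v) \<in> G \<and> similar d f v (fst (ug v)) (snd (ug v))"
    by (rule bchoice[THEN exE])
  define \<beta> \<gamma> where "\<beta> = fst \<circ> ug" and "\<gamma> = snd \<circ> ug"
  have \<beta>\<gamma>: "\<beta> v \<in> words d \<and> \<gamma> v \<in> G \<and> similar d f v (\<beta> v) (\<gamma> v)"
    if "v \<in> words d" "length v = n" for v
    using ug that by (simp add: \<beta>_def \<gamma>_def)
  define P where "P = {v \<in> words d. length v = n}"
  have P: "cone_partition d P" unfolding P_def by (rule cone_partition_level)
  have sim: "f (cons_inf p x) = cons_inf (\<beta> p) (act_inf (\<gamma> p) x)" "\<gamma> p \<in> G" "p \<in> words d" "\<beta> p \<in> words d"
    if "p \<in> P" "x \<in> inf_words d" for p x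
    using \<beta>\<gamma> that by (auto simp: similar_def P_def)
  \<comment> \<open>A common point of two image cones is pulled back through both labels;
    injectivity of \<open>f\<close> identifies the two preimages, which then lie in one cone of the
    level.\<close>
  have same: "p = q" if pq: "p \<in> P" "q \<in> P" and w: "w \<in> inf_words d" "has_prefix w (\<beta> p)" "has_prefix w (\<beta> q)" for p q w
  proof -
    obtain x where x: "w = cons_inf (\<beta> p) x" "x \<in> inf_words d"
      using has_prefixE_words[OF w(2,1)] by metis
    obtain y where y: "w = cons_inf (\<beta> q) y" "y \<in> inf_words d"
      using has_prefixE_words[OF w(3,1)] by metis
    obtain x' where x': "x' \<in> inf_words d" "act_inf (\<gamma> p) x' = x" using act_surj sim(2) pq x by metis
    obtain y' where y': "y' \<in> inf_words d" "act_inf (\<gamma> q) y' = y" using act_surj sim(2) pq y by metis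
    have "f (cons_inf p x') = f (cons_inf q y')"
      using sim(1)[OF pq(1) x'(1)] sim(1)[OF pq(2) y'(1)] x x' y y' by simp
    then have "cons_inf p x' = cons_inf q y'"
      using bij pq x' y' sim(3) by (simp add: bij_betw_def inj_on_def)
    then show "p = q"
      using cone_partition_unique[OF P, of "cons_inf p x'" p q] pq sim(3) x'(1)
      by (metis cons_inf_in_inf_words has_prefix_cons_inf)
  qed
  have "cone_partition d (\<beta> ` P)"
    unfolding cone_partition_def
  proof (intro conjI ballI ex_ex1I)
    show "finite (\<beta> ` P)" using cone_partition_finite[OF P] by simp
    show "\<beta> ` P \<subseteq> words d" using \<beta>\<gamma> by (auto simp: P_def)
    fix w assume w: "w \<in> inf_words d"
    then obtain w' where w': "w' \<in> inf_words d" "w = f w'" using bij by (auto simp: bij_betw_def)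
    then obtain p x where "p \<in> P" "x \<in> inf_words d" "w' = cons_inf p x"
      using cone_partitionE[OF P] by metis
    then have "\<beta> p \<in> \<beta> ` P \<and> has_prefix w (\<beta> p)"
      using sim w' by simp
    then show "\<exists>p. p \<in> \<beta> ` P \<and> has_prefix w p" by blast
    show "u = v" if "u \<in> \<beta> ` P \<and> has_prefix w u" "v \<in> \<beta> ` P \<and> has_prefix w v" for u v
      using that same[OF _ _ w] by auto
  qed
  moreover have "inj_on \<beta> P"
  proof (rule inj_onI)
    fix p q assume pq: "p \<in> P" "q \<in> P" "\<beta> p = \<beta> q"
    then show "p = q"
      using same[of p q "cons_inf (\<beta> p) (\<lambda>_. 0)"] sim(4) inf_words_nonempty[OF d_pos] by simp
  qed
  ultimately have "table d G P (\<beta> ` P) \<beta> \<gamma> f"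
    using P \<beta>\<gamma> off unfolding table_def bij_betw_def P_def by blast
  then show ?thesis unfolding P_def by blast
qed

text \<open>A table can be refined to the length of its longest word: a word of that length which is
  comparable with a member of \<open>P\<close> must extend it, and labels restrict to sections. This
  criterion is the working description of the group for composition, swaps and cone actions.\<close>

lemma V_set_iff:
  "f \<in> V_set d G \<longleftrightarrow> bij_betw f (inf_words d) (inf_words d) \<and> (\<forall>w. w \<notin> inf_words d \<longrightarrow> f w = w)
    \<and> (\<exists>n. \<forall>v\<in>words d. length v = n \<longrightarrow> (\<exists>u\<in>words d. \<exists>g\<in>G. similar d f v u g))"
proof
  assume "f \<in> V_set d G"
  then obtain P P' \<beta> \<gamma> where t: "table d G P P' \<beta> \<gamma> f" by (auto simp: V_set_iff_table[OF d_pos])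
  then have P: "cone_partition d P" and P': "cone_partition d P'"
    and \<beta>: "bij_betw \<beta> P P'" and \<gamma>: "\<And>p. p \<in> P \<Longrightarrow> \<gamma> p \<in> G"
    and sim: "\<And>p. p \<in> P \<Longrightarrow> similar d f p (\<beta> p) (\<gamma> p)"
    unfolding table_def by blast+
  define n where "n = Max (length ` P)"
  have "\<exists>u\<in>words d. \<exists>g\<in>G. similar d f v u g" if v: "v \<in> words d" "length v = n" for v
  proof -
    obtain p where p: "p \<in> P" "prefix p v \<or> prefix v p"
      using cone_partition_comparable[OF P d_pos v(1)] by blast
    have "length p \<le> n" using p cone_partition_finite[OF P] by (simp add: n_def)
    then obtain z where z: "v = p @ z" using p v
      by (metis append_Nil2 le_antisym not_equal_is_parallel parallelE prefixE prefix_length_le)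
    then have "similar d f v (\<beta> p @ \<gamma> p z) (tsection d (\<gamma> p) z)" "z \<in> words d"
      using similar_append[OF sim \<gamma>] p v by auto
    moreover have "\<beta> p \<in> words d" using \<beta> p cone_partition_words[OF P'] by (auto simp: bij_betw_def)
    ultimately show ?thesis
      using \<gamma>[OF p(1)] tree_aut_words[OF G_aut] G_tsection by (metis append_in_words)
  qed
  then show "bij_betw f (inf_words d) (inf_words d) \<and> (\<forall>w. w \<notin> inf_words d \<longrightarrow> f w = w)
    \<and> (\<exists>n. \<forall>v\<in>words d. length v = n \<longrightarrow> (\<exists>u\<in>words d. \<exists>g\<in>G. similar d f v u g))"
    using table_bij[OF t] t unfolding table_def by blast
next
  assume "bij_betw f (inf_words d) (inf_words d) \<and> (\<forall>w. w \<notin> inf_words d \<longrightarrow> f w = w)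
    \<and> (\<exists>n. \<forall>v\<in>words d. length v = n \<longrightarrow> (\<exists>u\<in>words d. \<exists>g\<in>G. similar d f v u g))"
  then obtain n where "\<exists>P' \<beta> \<gamma>. table d G {v \<in> words d. length v = n} P' \<beta> \<gamma> f"
    using table_of_level by blast
  then show "f \<in> V_set d G"
    using V_set_iff_table[OF d_pos] by blast
qed

lemma V_set_comp:
  assumes f: "f \<in> V_set d G" and h: "h \<in> V_set d G"
  shows "f \<circ> h \<in> V_set d G"
proof -
  obtain m where bf: "bij_betw f (inf_words d) (inf_words d)"
    and off: "\<And>w. w \<notin> inf_words d \<Longrightarrow> f w = w" "\<And>w. w \<notin> inf_words d \<Longrightarrow> h w = w"
    and m: "\<And>v. v \<in> words d \<Longrightarrow> length v = m \<Longrightarrow> \<exists>u\<in>words d. \<exists>g\<in>G. similar d f v u g"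
    using f h unfolding V_set_iff by blast
  obtain n where bh: "bij_betw h (inf_words d) (inf_words d)"
    and n: "\<And>v. v \<in> words d \<Longrightarrow> length v = n \<Longrightarrow> \<exists>u\<in>words d. \<exists>g\<in>G. similar d h v u g"
    using h unfolding V_set_iff by blast
  \<comment> \<open>The first \<open>n\<close> letters reach a cone on which \<open>h\<close> is
    understood. The other \<open>m\<close> letters survive as letters of the image word, which is
    therefore long enough for \<open>f\<close> to be understood on its cone.\<close>
  have "\<exists>u\<in>words d. \<exists>g\<in>G. similar d (f \<circ> h) v u g" if v: "v \<in> words d" "length v = n + m" for v
  proof -
    let ?a = "take n v" and ?b = "drop n v"
    have ab: "?a \<in> words d" "?b \<in> words d" "length ?a = n" "length ?b = m"
      using v by (auto simp: take_in_words drop_in_words)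
    obtain u g where u: "u \<in> words d" "g \<in> G" "similar d h ?a u g" using n ab by blast
    have h': "similar d h v (u @ g ?b) (tsection d g ?b)"
      using similar_append[OF u(3,2) ab(2)] by simp
    let ?p = "take m (u @ g ?b)" and ?q = "drop m (u @ g ?b)"
    have "u @ g ?b \<in> words d" using u ab tree_aut_words[OF G_aut] by simp
    then have pq: "?p \<in> words d" "?q \<in> words d"
      by (rule take_in_words drop_in_words)+
    have lp: "length ?p = m"
      using tree_aut_length[OF G_aut[OF u(2)], of ?b] ab by simp
    obtain u2 g2 where u2: "u2 \<in> words d" "g2 \<in> G" "similar d f ?p u2 g2" using m[OF pq(1) lp] by blast
    have f': "similar d f (u @ g ?b) (u2 @ g2 ?q) (tsection d g2 ?q)"
      using similar_append[OF u2(3,2) pq(2)] by (simp only: append_take_drop_id)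
    have "similar d (f \<circ> h) v (u2 @ g2 ?q) (tsection d g2 ?q \<circ> tsection d g ?b)"
      unfolding similar_def
    proof
      fix w assume w: "w \<in> inf_words d"
      let ?w = "act_inf (tsection d g ?b) w"
      have "(f \<circ> h) (cons_inf v w) = f (cons_inf (u @ g ?b) ?w)"
        using h' w by (simp add: similar_def)
      also have "\<dots> = cons_inf (u2 @ g2 ?q) (act_inf (tsection d g2 ?q) ?w)"
        using f' act_in[OF G_tsection[OF ab(2) u(2)] w] unfolding similar_def by blast
      finally show "(f \<circ> h) (cons_inf v w) = cons_inf (u2 @ g2 ?q) (act_inf (tsection d g2 ?q \<circ> tsection d g ?b) w)"
        using act_comp[OF G_tsection[OF ab(2) u(2)] w] by simp
    qed
    moreover have "u2 @ g2 ?q \<in> words d"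
      using u2 tree_aut_words[OF G_aut[OF u2(2)] pq(2)] by simp
    moreover have "tsection d g2 ?q \<circ> tsection d g ?b \<in> G"
      by (intro G_comp G_tsection ab pq u u2)
    ultimately show ?thesis by blast
  qed
  then show ?thesis
    unfolding V_set_iff using bij_betw_trans[OF bh bf] off by auto
qed

lemma V_set_id: "id \<in> V_set d G"
  unfolding V_set_iff using G_id by (auto simp: similar_def intro!: exI[of _ 0] bexI[of _ id] bexI[of _ "[]"])

text \<open>Inversion exchanges the two partitions of a table and inverts the labels. The target
  partition need not be a single level, hence tables instead of the level criterion.\<close>

lemma V_set_inv:
  assumes f: "f \<in> V_set d G"
  shows "\<exists>h\<in>V_set d G. h \<circ> f = id"
proof -
  obtain P P' \<beta> \<gamma> where t: "table d G P P' \<beta> \<gamma> f" using f by (auto simp: V_set_iff_table[OF d_pos])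
  then have P: "cone_partition d P" and P': "cone_partition d P'"
    and \<beta>: "bij_betw \<beta> P P'" and \<gamma>: "\<And>p. p \<in> P \<Longrightarrow> \<gamma> p \<in> G"
    and sim: "\<And>p. p \<in> P \<Longrightarrow> similar d f p (\<beta> p) (\<gamma> p)"
    and off: "\<And>w. w \<notin> inf_words d \<Longrightarrow> f w = w"
    unfolding table_def by blast+
  note bij = table_bij[OF t]
  define h where "h = (\<lambda>w. if w \<in> inf_words d then inv_into (inf_words d) f w else w)"
  have hf: "h (f w) = w" for w
  proof (cases "w \<in> inf_words d")
    case True
    then show ?thesis using bij_betw_inv_into_left[OF bij True] bij_betwE[OF bij] by (simp add: h_def)
  qed (simp add: off h_def)
  define \<beta>' where "\<beta>' = the_inv_into P \<beta>"
  have \<beta>': "bij_betw \<beta>' P' P" unfolding \<beta>'_def using \<beta> by (rule bij_betw_the_inv_into)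
  have "\<forall>q\<in>P'. \<exists>g. g \<in> G \<and> similar d h q (\<beta>' q) g"
  proof
    fix q assume "q \<in> P'"
    then have p: "\<beta>' q \<in> P" and \<beta>p: "\<beta> (\<beta>' q) = q"
      using \<beta> by (auto simp: \<beta>'_def bij_betw_def the_inv_into_into f_the_inv_into_f)
    obtain g where g: "g \<in> G" "\<gamma> (\<beta>' q) \<circ> g = id" using G_inv[OF \<gamma>[OF p]] by metis
    have "h (cons_inf q w) = cons_inf (\<beta>' q) (act_inf g w)" if w: "w \<in> inf_words d" for w
    proof -
      have "f (cons_inf (\<beta>' q) (act_inf g w)) = cons_inf q w"
        using sim[OF p] act_in[OF g(1) w] act_comp[OF g(1) w] g(2) \<beta>p by (simp add: similar_def)
      then show ?thesis using hf by metis
    qed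
    then show "\<exists>g. g \<in> G \<and> similar d h q (\<beta>' q) g" using g(1) by (auto simp: similar_def)
  qed
  then obtain \<delta> where "\<forall>q\<in>P'. \<delta> q \<in> G \<and> similar d h q (\<beta>' q) (\<delta> q)" by (rule bchoice[THEN exE])
  then have "table d G P' P \<beta>' \<delta> h"
    using P P' \<beta>' by (simp add: table_def h_def)
  then have "h \<in> V_set d G" using V_set_iff_table[OF d_pos] by blast
  then show ?thesis using hf by (auto simp: fun_eq_iff)
qed

end

lemma V_group_simps [simp]:
  "carrier (V_group d G) = V_set d G"
  "monoid.mult (V_group d G) = (\<circ>)"
  "one (V_group d G) = id"
  by (simp_all add: V_group_def)

lemma (in self_similar_group) group_V_group: "group (V_group d G)"
  by (rule groupI) (auto simp: V_set_comp V_set_id V_set_inv o_assoc)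

subsection \<open>Swaps of cones and actions on a cone\<close>

definition cone_swap :: "nat \<Rightarrow> nat list \<Rightarrow> nat list \<Rightarrow> (nat \<Rightarrow> nat) \<Rightarrow> (nat \<Rightarrow> nat)" where
  "cone_swap d u v w =
    (if w \<notin> inf_words d then w
     else if has_prefix w u then cons_inf v (\<lambda>k. w (k + length u))
     else if has_prefix w v then cons_inf u (\<lambda>k. w (k + length v))
     else w)"

definition cone_act :: "nat \<Rightarrow> nat list \<Rightarrow> (nat list \<Rightarrow> nat list) \<Rightarrow> (nat \<Rightarrow> nat) \<Rightarrow> (nat \<Rightarrow> nat)" where
  "cone_act d v g w =
    (if w \<in> inf_words d \<and> has_prefix w v then cons_inf v (act_inf g (\<lambda>k. w (k + length v))) else w)"

lemma cone_swap_off: "w \<notin> inf_words d \<Longrightarrow> cone_swap d u v w = w"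
  by (simp add: cone_swap_def)

lemma cone_swap_left:
  "u \<in> words d \<Longrightarrow> x \<in> inf_words d \<Longrightarrow> cone_swap d u v (cons_inf u x) = cons_inf v x"
  by (simp add: cone_swap_def)

lemma cone_swap_right:
  "parallel u v \<Longrightarrow> v \<in> words d \<Longrightarrow> x \<in> inf_words d \<Longrightarrow> cone_swap d u v (cons_inf v x) = cons_inf u x"
  by (simp add: cone_swap_def)

lemma cone_swap_other: "\<not> has_prefix w u \<Longrightarrow> \<not> has_prefix w v \<Longrightarrow> cone_swap d u v w = w"
  by (simp add: cone_swap_def)

lemma cone_act_off: "w \<notin> inf_words d \<Longrightarrow> cone_act d v g w = w"
  by (simp add: cone_act_def)

lemma cone_act_at:
  "v \<in> words d \<Longrightarrow> x \<in> inf_words d \<Longrightarrow> cone_act d v g (cons_inf v x) = cons_inf v (act_inf g x)"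
  by (simp add: cone_act_def)

lemma cone_act_other: "\<not> has_prefix w v \<Longrightarrow> cone_act d v g w = w"
  by (simp add: cone_act_def)

lemma cone_swap_invol:
  assumes "parallel u v" "u \<in> words d" "v \<in> words d"
  shows "cone_swap d u v \<circ> cone_swap d u v = id"
proof
  fix w
  consider "w \<notin> inf_words d" | x where "x \<in> inf_words d" "w = cons_inf u x"
    | x where "x \<in> inf_words d" "w = cons_inf v x" | "\<not> has_prefix w u" "\<not> has_prefix w v"
    by (metis has_prefixE_words)
  then show "(cone_swap d u v \<circ> cone_swap d u v) w = id w"
    using assms by cases (simp_all add: cone_swap_off cone_swap_left cone_swap_right cone_swap_other)
qed

text \<open>The identity (v c)(u v)(v c) = (u c) for transpositions, which carries over to cones
  because the three are pairwise disjoint. It is the source of all relations between classes of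
  swaps.\<close>

lemma cone_swap_conj:
  assumes uv: "parallel u v" and uc: "parallel u c" and vc: "parallel v c" and W: "u \<in> words d" "v \<in> words d" "c \<in> words d"
  shows "cone_swap d v c \<circ> cone_swap d u v \<circ> cone_swap d v c = cone_swap d u c"
proof
  fix w
  consider "w \<notin> inf_words d" | x where "x \<in> inf_words d" "w = cons_inf u x"
    | x where "x \<in> inf_words d" "w = cons_inf v x" | x where "x \<in> inf_words d" "w = cons_inf c x"
    | "\<not> has_prefix w u" "\<not> has_prefix w v" "\<not> has_prefix w c"
    by (metis has_prefixE_words)
  then show "(cone_swap d v c \<circ> cone_swap d u v \<circ> cone_swap d v c) w = cone_swap d u c w"
    using assms by cases (simp_all add: cone_swap_off cone_swap_left cone_swap_right cone_swap_other)
qed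

lemma cone_swap_commute:
  assumes "parallel u v" "u \<in> words d" "v \<in> words d"
  shows "cone_swap d u v = cone_swap d v u"
proof
  fix w
  consider "w \<notin> inf_words d" | x where "x \<in> inf_words d" "w = cons_inf u x"
    | x where "x \<in> inf_words d" "w = cons_inf v x" | "\<not> has_prefix w u" "\<not> has_prefix w v"
    by (metis has_prefixE_words)
  moreover have "parallel v u" using assms by (simp add: parallel_commute)
  ultimately show "cone_swap d u v w = cone_swap d v u w"
    using assms by cases (simp_all add: cone_swap_off cone_swap_left cone_swap_right cone_swap_other)
qed

context self_similar_group
begin

text \<open>A swap only replaces prefixes, so it moves an action to a disjoint cone without altering
  the label.\<close>

lemma cone_swap_act_conj:
  assumes uv: "parallel u v" and W: "u \<in> words d" "v \<in> words d" and g: "g \<in> G"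
  shows "cone_swap d u v \<circ> cone_act d u g \<circ> cone_swap d u v = cone_act d v g"
proof
  fix w
  consider "w \<notin> inf_words d" | x where "x \<in> inf_words d" "w = cons_inf u x"
    | x where "x \<in> inf_words d" "w = cons_inf v x" | "\<not> has_prefix w u" "\<not> has_prefix w v"
    by (metis has_prefixE_words)
  then show "(cone_swap d u v \<circ> cone_act d u g \<circ> cone_swap d u v) w = cone_act d v g w"
    using uv W act_in[OF g]
    by cases (simp_all add: cone_swap_off cone_swap_left cone_swap_right cone_swap_other
        cone_act_off cone_act_at cone_act_other)
qed

lemma cone_act_comp:
  assumes v: "v \<in> words d" and g: "g \<in> G"
  shows "cone_act d v h \<circ> cone_act d v g = cone_act d v (h \<circ> g)"
proof
  fix w
  consider "w \<notin> inf_words d" | x where "x \<in> inf_words d" "w = cons_inf v x" | "\<not> has_prefix w v"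
    by (metis has_prefixE_words)
  then show "(cone_act d v h \<circ> cone_act d v g) w = cone_act d v (h \<circ> g) w"
    using v act_in[OF g] act_comp[OF g]
    by cases (simp_all add: cone_act_off cone_act_at cone_act_other)
qed

lemma cone_act_id:
  assumes v: "v \<in> words d"
  shows "cone_act d v id = id"
proof
  fix w
  consider "w \<notin> inf_words d" | x where "x \<in> inf_words d" "w = cons_inf v x" | "\<not> has_prefix w v"
    by (metis has_prefixE_words)
  then show "cone_act d v id w = id w"
    using v by cases (simp_all add: cone_act_off cone_act_at cone_act_other)
qed

lemma cone_swap_in_V:
  assumes uv: "parallel u v" and W: "u \<in> words d" "v \<in> words d"
  shows "cone_swap d u v \<in> V_set d G"
  unfolding V_set_iff
proof (intro conjI)
  have inv: "cone_swap d u v (cone_swap d u v w) = w" for w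
    using cone_swap_invol[OF assms] by (metis comp_apply id_apply)
  have into: "cone_swap d u v w \<in> inf_words d" if w: "w \<in> inf_words d" for w
    using W w shift_in_inf_words[OF w] by (simp add: cone_swap_def)
  show "bij_betw (cone_swap d u v) (inf_words d) (inf_words d)"
    by (rule bij_betw_byWitness[where f' = "cone_swap d u v"]) (use inv into in auto)
  show "\<forall>w. w \<notin> inf_words d \<longrightarrow> cone_swap d u v w = w" by (simp add: cone_swap_off)
  \<comment> \<open>At this level no word is a proper prefix of \<open>u\<close> or
    \<open>v\<close>, so each one extends \<open>u\<close>, extends \<open>v\<close>, or is disjoint
    from both.\<close>
  have "\<exists>p\<in>words d. \<exists>g\<in>G. similar d (cone_swap d u v) q p g"
    if q: "q \<in> words d" "length q = max (length u) (length v)" for q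
  proof -
    consider z where "q = u @ z" | z where "q = v @ z" | "\<not> prefix u q" "\<not> prefix v q"
      by (metis prefixE)
    then have "\<exists>p\<in>words d. similar d (cone_swap d u v) q p id"
    proof cases
      case (1 z)
      then show ?thesis using W q
        by (intro bexI[of _ "v @ z"]) (auto simp: similar_def cone_swap_left)
    next
      case (2 z)
      then show ?thesis using W q uv
        by (intro bexI[of _ "u @ z"]) (auto simp: similar_def cone_swap_right)
    next
      case 3
      then have "\<not> has_prefix (cons_inf q w) u" "\<not> has_prefix (cons_inf q w) v" for w
        using q(2) has_prefix_linear[OF _ has_prefix_cons_inf] by (metis max.cobounded1, metis max.cobounded2)
      then show ?thesis using q
        by (intro bexI[of _ q]) (auto simp: similar_def cone_swap_other)
    qed
    then show ?thesis using G_id by blast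
  qed
  then show "\<exists>n. \<forall>v'\<in>words d. length v' = n \<longrightarrow> (\<exists>p\<in>words d. \<exists>g\<in>G. similar d (cone_swap d u v) v' p g)"
    by blast
qed

lemma cone_act_in_V:
  assumes v: "v \<in> words d" and g: "g \<in> G"
  shows "cone_act d v g \<in> V_set d G"
  unfolding V_set_iff
proof (intro conjI)
  obtain h where h: "h \<in> G" "h \<circ> g = id" "g \<circ> h = id" using G_inv[OF g] by metis
  have "cone_act d v h \<circ> cone_act d v g = id" "cone_act d v g \<circ> cone_act d v h = id"
    using cone_act_comp[OF v] g h cone_act_id[OF v] by auto
  then have inv: "cone_act d v h (cone_act d v g w) = w" "cone_act d v g (cone_act d v h w) = w" for w
    by (metis comp_apply id_apply)+
  have into: "cone_act d v k w \<in> inf_words d" if w: "w \<in> inf_words d" and k: "k \<in> G" for w k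
    using v w act_in[OF k shift_in_inf_words[OF w]] by (simp add: cone_act_def)
  show "bij_betw (cone_act d v g) (inf_words d) (inf_words d)"
    by (rule bij_betw_byWitness[where f' = "cone_act d v h"]) (use inv into g h in auto)
  show "\<forall>w. w \<notin> inf_words d \<longrightarrow> cone_act d v g w = w" by (simp add: cone_act_off)
  have "\<exists>p\<in>words d. \<exists>g'\<in>G. similar d (cone_act d v g) q p g'"
    if q: "q \<in> words d" "length q = length v" for q
  proof (cases "q = v")
    case True
    then have "similar d (cone_act d v g) q v g" using v by (simp add: similar_def cone_act_at)
    then show ?thesis using v g by blast
  next
    case False
    then have "\<not> has_prefix (cons_inf q w) v" for w
      using q(2) has_prefix_linear[OF _ has_prefix_cons_inf] by (metis le_refl not_equal_is_parallel parallelE)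
    then have "similar d (cone_act d v g) q q id" by (simp add: similar_def cone_act_other)
    then show ?thesis using q G_id by blast
  qed
  then show "\<exists>n. \<forall>v'\<in>words d. length v' = n \<longrightarrow> (\<exists>p\<in>words d. \<exists>g'\<in>G. similar d (cone_act d v g) v' p g')"
    by blast
qed

end

subsection \<open>Generation by swaps and cone actions\<close>

text \<open>A longest word \<open>p\<close> of \<open>P\<close> is the end of a caret. A member of
  \<open>P\<close> comparable with a sibling of \<open>p\<close> cannot be shorter, as it would be a
  proper prefix of \<open>p\<close>, and cannot be longer by maximality.\<close>

lemma cone_partition_caret:
  assumes P: "cone_partition d P" and d: "0 < d" and nil: "[] \<notin> P"
  shows "\<exists>u\<in>words d. \<forall>x<d. u @ [x] \<in> P"
proof -
  have fin: "finite P" and ne: "P \<noteq> {}"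
    using cone_partition_finite[OF P] cone_partition_comparable[OF P d, of "[]"] by auto
  define m where "m = Max (length ` P)"
  have le: "length p \<le> m" if "p \<in> P" for p using that fin by (simp add: m_def)
  have "m \<in> length ` P" unfolding m_def using fin ne by (intro Max_in) auto
  then obtain p where p: "p \<in> P" "length p = m" by auto
  then obtain u y where u: "p = u @ [y]" using nil by (metis rev_exhaust)
  then have uw: "u \<in> words d" using cone_partition_words[OF P p(1)] by simp
  have "u @ [x] \<in> P" if x: "x < d" for x
  proof -
    obtain q where q: "q \<in> P" "prefix q (u @ [x]) \<or> prefix (u @ [x]) q"
      using cone_partition_comparable[OF P d, of "u @ [x]"] uw x by auto
    have "\<not> prefix q u"
    proof
      assume qu: "prefix q u"
      then have "prefix q p" using u by simp
      then have "q = p" using cone_partition_prefix_eq[OF P d q(1) p(1)] by simp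
      then show False using qu u by (auto dest!: prefix_length_le)
    qed
    moreover have "q = u @ [x]" if "prefix (u @ [x]) q"
      using that le[OF q(1)] p u by (auto simp: prefix_def)
    ultimately show ?thesis using q by auto
  qed
  then show ?thesis using uw by blast
qed

lemma cone_partition_Nil:
  assumes P: "cone_partition d P" and d: "0 < d" and "[] \<in> P"
  shows "P = {[]}"
  using cone_partition_prefix_eq[OF P d assms(3)] assms(3) by auto

text \<open>Lets two partitions of equal size be recognised as trivial at the same time, as the
  induction on table size requires.\<close>

lemma cone_partition_card_1:
  assumes P: "cone_partition d P" and d: "2 \<le> d"
  shows "card P = 1 \<longleftrightarrow> P = {[]}"
proof
  assume "card P = 1"
  then obtain p where p: "P = {p}" by (auto simp: card_1_singleton_iff)
  have "[] \<in> P"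
  proof (rule ccontr)
    assume "[] \<notin> P"
    then obtain u where "\<forall>x<d. u @ [x] \<in> P" using cone_partition_caret[OF P] d by auto
    then have "u @ [0] \<in> P" "u @ [1] \<in> P" using d by auto
    then show False using p by auto
  qed
  then show "P = {[]}" using p by auto
qed simp

text \<open>Contracting a caret trades d words for one. The size drops by d - 1, which is positive
  because \<open>2 \<le> d\<close>; this drives the induction on \<open>card P\<close>.\<close>

lemma cone_partition_merge:
  assumes P: "cone_partition d P" and d: "2 \<le> d" and u: "u \<in> words d" and up: "\<forall>x<d. u @ [x] \<in> P"
  defines "C \<equiv> (\<lambda>x. u @ [x]) ` {..<d}"
  shows "u \<notin> P" "C \<subseteq> P" "cone_partition d (insert u (P - C))" "card (insert u (P - C)) < card P"
proof -
  have d0: "0 < d" using d by simp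
  show uP: "u \<notin> P"
    using cone_partition_prefix_eq[OF P d0, of u "u @ [0]"] up d0 by auto
  show C: "C \<subseteq> P" using up by (auto simp: C_def)
  have fin: "finite P" using cone_partition_finite[OF P] .
  have "card C = d" unfolding C_def by (subst card_image) (auto simp: inj_on_def)
  moreover have "card C \<le> card P" using C fin by (rule card_mono[rotated])
  moreover have "finite C" using C fin finite_subset by blast
  ultimately show "card (insert u (P - C)) < card P"
    using uP fin C d by (simp add: card_Diff_subset)
  show "cone_partition d (insert u (P - C))"
    unfolding cone_partition_def
  proof (intro conjI ballI)
    show "finite (insert u (P - C))" using fin by simp
    show "insert u (P - C) \<subseteq> words d" using u cone_partition_words[OF P] by auto
    fix w assume w: "w \<in> inf_words d"
    have child: "\<exists>q\<in>C. has_prefix w q" if wu: "has_prefix w u"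
    proof -
      obtain x where x: "w = cons_inf u x" "x \<in> inf_words d" using has_prefixE_words[OF wu w] by metis
      then have "w = cons_inf (u @ [x 0]) (\<lambda>k. x (k + 1))"
        using cons_inf_take_shift[of x 1] by simp
      then have "has_prefix w (u @ [x 0])" using has_prefix_cons_inf by metis
      moreover have "x 0 < d" using x by (simp add: inf_words_def)
      ultimately show ?thesis by (auto simp: C_def)
    qed
    obtain p where p: "p \<in> P" "has_prefix w p" using P w unfolding cone_partition_def by blast
    have uniq: "q = p" if "q \<in> P" "has_prefix w q" for q
      using cone_partition_unique[OF P w] p that by blast
    show "\<exists>!q. q \<in> insert u (P - C) \<and> has_prefix w q"
    proof (cases "p \<in> C")
      case True
      then have "has_prefix w u" using p(2) has_prefix_mono by (auto simp: C_def)
      then show ?thesis using uniq True by blast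
    next
      case False
      then have "\<not> has_prefix w u" using child uniq C by blast
      then show ?thesis using uniq p False by blast
    qed
  qed
qed

lemma (in group) subgroup_cancel_left:
  "subgroup H G \<Longrightarrow> s \<in> H \<Longrightarrow> f \<in> carrier G \<Longrightarrow> s \<otimes> f \<in> H \<Longrightarrow> f \<in> H"
  by (metis inv_solve_left' subgroup.m_closed subgroup.m_inv_closed subgroup.mem_carrier)

lemma (in group) subgroup_cancel_right:
  "subgroup H G \<Longrightarrow> s \<in> H \<Longrightarrow> f \<in> carrier G \<Longrightarrow> f \<otimes> s \<in> H \<Longrightarrow> f \<in> H"
  by (metis inv_solve_right' subgroup.m_closed subgroup.m_inv_closed subgroup.mem_carrier)

context self_similar_group
begin

lemma table_cone_swap:
  assumes t: "table d G P P' \<beta> (\<lambda>_. id) f" and q: "q \<in> P'" "q' \<in> P'" "q \<noteq> q'"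
  shows "table d G P P' (Transposition.transpose q q' \<circ> \<beta>) (\<lambda>_. id) (cone_swap d q q' \<circ> f)"
proof -
  have P: "cone_partition d P" and P': "cone_partition d P'" and \<beta>: "bij_betw \<beta> P P'"
    and sim: "\<And>p. p \<in> P \<Longrightarrow> similar d f p (\<beta> p) id"
    and off: "\<And>w. w \<notin> inf_words d \<Longrightarrow> f w = w"
    using t unfolding table_def by blast+
  note par = cone_partition_parallel[OF P' d_pos]
  note qw = cone_partition_words[OF P' q(1)] cone_partition_words[OF P' q(2)]
  show ?thesis
    unfolding table_def
  proof (intro conjI ballI allI impI P P' G_id)
    have "bij_betw (Transposition.transpose q q') P' P'"
      using q by simp
    then show "bij_betw (Transposition.transpose q q' \<circ> \<beta>) P P'" using \<beta> bij_betw_trans by blast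
    fix p assume p: "p \<in> P"
    then have bp: "\<beta> p \<in> P'" using \<beta> by (auto simp: bij_betw_def)
    show "similar d (cone_swap d q q' \<circ> f) p ((Transposition.transpose q q' \<circ> \<beta>) p) id"
      using sim[OF p] par[OF q] par[OF bp q(1)] par[OF bp q(2)] qw
      by (auto simp: similar_def Transposition.transpose_def cone_swap_left cone_swap_right cone_swap_other)
  qed (simp add: off cone_swap_off)
qed

section \<open>Subgroups that contain all cone swaps\<close>

context
  fixes H
  assumes H: "subgroup H (V_group d G)"
    and swap_H: "\<And>u v. parallel u v \<Longrightarrow> u \<in> words d \<Longrightarrow> v \<in> words d \<Longrightarrow> cone_swap d u v \<in> H"
begin

text \<open>The children are put into place one by one, as in a selection sort. The transposition
  for child \<open>k\<close> leaves the earlier ones alone: their images differ from the current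
  image of child \<open>k\<close> by injectivity, and from its destination by the last
  letter.\<close>

lemma table_align_caret:
  assumes t: "table d G P P' \<beta> (\<lambda>_. id) f"
    and u: "\<forall>x<d. u @ [x] \<in> P" and u': "\<forall>x<d. u' @ [x] \<in> P'"
  shows "k \<le> d \<Longrightarrow> \<exists>s\<in>H. \<exists>\<beta>'. table d G P P' \<beta>' (\<lambda>_. id) (s \<circ> f) \<and> (\<forall>x<k. \<beta>' (u @ [x]) = u' @ [x])"
proof (induction k)
  case 0
  have "id \<in> H" using subgroup.one_closed[OF H] by simp
  moreover have "table d G P P' \<beta> (\<lambda>_. id) (id \<circ> f)" using t by (simp only: id_comp)
  ultimately show ?case by blast
next
  case (Suc k)
  then obtain s \<beta>' where s: "s \<in> H" and t': "table d G P P' \<beta>' (\<lambda>_. id) (s \<circ> f)"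
    and al: "\<forall>x<k. \<beta>' (u @ [x]) = u' @ [x]" by (meson Suc_leD)
  let ?q = "\<beta>' (u @ [k])" and ?q' = "u' @ [k]"
  have \<beta>': "bij_betw \<beta>' P P'" and P': "cone_partition d P'" using t' by (auto simp: table_def)
  have uk: "u @ [k] \<in> P" "?q' \<in> P'" using u u' Suc.prems by auto
  then have q: "?q \<in> P'" using \<beta>' by (auto simp: bij_betw_def)
  show ?case
  proof (cases "?q = ?q'")
    case True
    then have "\<forall>x<Suc k. \<beta>' (u @ [x]) = u' @ [x]" using al by (auto simp: less_Suc_eq)
    then show ?thesis using s t' by blast
  next
    case False
    let ?s = "cone_swap d ?q ?q'"
    have "?s \<in> H"
      using swap_H[OF cone_partition_parallel[OF P' d_pos q uk(2) False]] cone_partition_words[OF P'] q uk by blast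
    then have "?s \<circ> s \<in> H" using subgroup.m_closed[OF H] s by simp
    moreover have "table d G P P' (Transposition.transpose ?q ?q' \<circ> \<beta>') (\<lambda>_. id) (?s \<circ> s \<circ> f)"
      using table_cone_swap[OF t' q uk(2) False] by (simp only: o_assoc)
    moreover have "(Transposition.transpose ?q ?q' \<circ> \<beta>') (u @ [x]) = u' @ [x]" if x: "x < Suc k" for x
    proof (cases "x = k")
      case False
      have "u @ [x] \<in> P" using u x Suc.prems by auto
      then have "\<beta>' (u @ [x]) \<noteq> ?q"
        using \<beta>' uk False by (auto simp: bij_betw_def dest: inj_onD)
      then show ?thesis using al x False by (simp add: Transposition.transpose_def)
    qed simp
    ultimately show ?thesis by blast
  qed
qed

text \<open>After composing with swaps so that a deepest caret of \<open>P\<close> is sent identically to a caret of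
  \<open>P'\<close>, both carets can be contracted.\<close>

lemma label_free_in_subgroup:
  "table d G P P' \<beta> (\<lambda>_. id) f \<Longrightarrow> f \<in> H"
proof (induction "card P" arbitrary: P P' \<beta> f rule: less_induct)
  case less
  have P: "cone_partition d P" and P': "cone_partition d P'" and \<beta>: "bij_betw \<beta> P P'"
    using less.prems by (auto simp: table_def)
  have f: "f \<in> V_set d G" using less.prems V_set_iff_table[OF d_pos] by blast
  have card: "card P = card P'" using \<beta> by (rule bij_betw_same_card)
  interpret V: group "V_group d G" by (rule group_V_group)
  show ?case
  proof (cases "[] \<in> P")
    case True
    then have "P = {[]}" using cone_partition_Nil[OF P d_pos] by simp
    moreover from this have "P' = {[]}" using card cone_partition_card_1[OF P' d_ge_2] by simp
    ultimately have "f w = w" for w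
      using less.prems by (cases "w \<in> inf_words d") (auto simp: table_def similar_def bij_betw_def)
    then have "f = id" by auto
    then show ?thesis using subgroup.one_closed[OF H] by simp
  next
    case False
    then have "P \<noteq> {[]}" by auto
    then have "[] \<notin> P'"
      using card cone_partition_card_1[OF P d_ge_2] cone_partition_Nil[OF P' d_pos] by auto
    then obtain u' where u': "u' \<in> words d" "\<forall>x<d. u' @ [x] \<in> P'"
      using cone_partition_caret[OF P' d_pos] by blast
    obtain u where u: "u \<in> words d" "\<forall>x<d. u @ [x] \<in> P"
      using cone_partition_caret[OF P d_pos False] by blast
    obtain s \<beta>' where s: "s \<in> H" and t': "table d G P P' \<beta>' (\<lambda>_. id) (s \<circ> f)"
      and al: "\<forall>x<d. \<beta>' (u @ [x]) = u' @ [x]"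
      using table_align_caret[OF less.prems u(2) u'(2) order_refl] by blast
    let ?C = "(\<lambda>x. u @ [x]) ` {..<d}" and ?C' = "(\<lambda>x. u' @ [x]) ` {..<d}"
    note mP = cone_partition_merge[OF P d_ge_2 u] and mP' = cone_partition_merge[OF P' d_ge_2 u']
    have \<beta>': "bij_betw \<beta>' P P'" and sim: "\<And>p. p \<in> P \<Longrightarrow> similar d (s \<circ> f) p (\<beta>' p) id"
      and off: "\<And>w. w \<notin> inf_words d \<Longrightarrow> (s \<circ> f) w = w"
      using t' by (auto simp: table_def)
    have "\<beta>' ` ?C = ?C'" using al by (auto simp: image_iff)
    then have bC: "bij_betw \<beta>' (P - ?C) (P' - ?C')"
      using \<beta>' mP(2) mP'(2) by (auto simp: bij_betw_def inj_on_diff inj_on_image_set_diff[of _ P])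
    then have "bij_betw (\<beta>'(u := u')) (P - ?C) (P' - ?C')"
      using mP(1) by (subst bij_betw_cong[of _ _ \<beta>']) auto
    then have b1: "bij_betw (\<beta>'(u := u')) (insert u (P - ?C)) (insert u' (P' - ?C'))"
      using mP(1) mP'(1) notIn_Un_bij_betw[of u "P - ?C" "\<beta>'(u := u')" "P' - ?C'"] by simp
    \<comment> \<open>Every child of \<open>u\<close> goes to the child of \<open>u'\<close> with
      the same letter and with trivial label, so the first letter \<open>w 0\<close> passes through
      unchanged and the two carets contract to one pair of cones.\<close>
    have "similar d (s \<circ> f) u u' id"
      unfolding similar_def
    proof
      fix w assume w: "w \<in> inf_words d"
      have w0: "cons_inf [w 0] (\<lambda>k. w (k + 1)) = w" using cons_inf_take_shift[of w 1] by simp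
      have "w 0 < d" using w by (simp add: inf_words_def)
      then have "similar d (s \<circ> f) (u @ [w 0]) (u' @ [w 0]) id" using sim[of "u @ [w 0]"] u al by simp
      then have "(s \<circ> f) (cons_inf (u @ [w 0]) (\<lambda>k. w (k + 1))) = cons_inf (u' @ [w 0]) (\<lambda>k. w (k + 1))"
        using shift_in_inf_words[OF w] unfolding similar_def by (metis act_inf_id)
      then show "(s \<circ> f) (cons_inf u w) = cons_inf u' (act_inf id w)"
        unfolding cons_inf_append w0 act_inf_id .
    qed
    then have "table d G (insert u (P - ?C)) (insert u' (P' - ?C')) (\<beta>'(u := u')) (\<lambda>_. id) (s \<circ> f)"
      using mP(3) mP'(3) b1 sim off mP(1) G_id unfolding table_def by auto
    then have "s \<circ> f \<in> H" using less.hyps mP(4) by blast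
    then show ?thesis using V.subgroup_cancel_left[OF H s] f by simp
  qed
qed

section \<open>Subgroups that also contain the actions on proper cones\<close>

context
  assumes act_H: "\<And>v g. v \<in> words d \<Longrightarrow> v \<noteq> [] \<Longrightarrow> g \<in> G \<Longrightarrow> cone_act d v g \<in> H"
begin

text \<open>The inverse label, applied first on the cone of \<open>p\<close>, cancels the label
  there; the other cones of \<open>P\<close> are disjoint from it and keep theirs. The empty word is
  excluded because actions are available on proper cones only.\<close>

lemma table_remove_labels:
  assumes t: "table d G P P' \<beta> \<gamma> f" and nil: "[] \<notin> P"
  shows "finite S \<Longrightarrow> S \<subseteq> P \<Longrightarrow>
    \<exists>s\<in>H. \<exists>\<gamma>'. table d G P P' \<beta> \<gamma>' (f \<circ> s) \<and> (\<forall>p\<in>S. \<gamma>' p = id)"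
proof (induction S rule: finite_induct)
  case empty
  have "id \<in> H" using subgroup.one_closed[OF H] by simp
  moreover have "table d G P P' \<beta> \<gamma> (f \<circ> id)" using t by (simp only: comp_id)
  ultimately show ?case by blast
next
  case (insert p S)
  then obtain s \<gamma>' where s: "s \<in> H" and t': "table d G P P' \<beta> \<gamma>' (f \<circ> s)"
    and id: "\<forall>p\<in>S. \<gamma>' p = id" by (meson insert_subset)
  have P: "cone_partition d P" and sim: "\<And>q. q \<in> P \<Longrightarrow> similar d (f \<circ> s) q (\<beta> q) (\<gamma>' q)"
    and \<gamma>': "\<And>q. q \<in> P \<Longrightarrow> \<gamma>' q \<in> G" using t' by (auto simp: table_def)
  have p: "p \<in> P" "p \<in> words d" "p \<noteq> []" using insert.prems nil cone_partition_words[OF P] by auto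
  obtain h where h: "h \<in> G" "\<gamma>' p \<circ> h = id" using G_inv[OF \<gamma>'[OF p(1)]] by metis
  let ?s = "s \<circ> cone_act d p h"
  have "?s \<in> H" using subgroup.m_closed[OF H s act_H[OF p(2,3) h(1)]] by simp
  moreover have "similar d (f \<circ> ?s) q (\<beta> q) ((\<gamma>'(p := id)) q)" if q: "q \<in> P" for q
  proof (cases "q = p")
    case True
    then show ?thesis
      using sim[OF p(1)] act_in[OF h(1)] act_comp[OF h(1)] h(2) p(2)
      by (simp add: similar_def cone_act_at)
  next
    case False
    then have "parallel q p" using cone_partition_parallel[OF P d_pos q p(1)] by simp
    then show ?thesis using sim[OF q] False by (simp add: similar_def cone_act_other)
  qed
  then have "table d G P P' \<beta> (\<gamma>'(p := id)) (f \<circ> ?s)"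
    using t' G_id by (auto simp: table_def cone_act_off)
  moreover have "\<forall>q\<in>insert p S. (\<gamma>'(p := id)) q = id" using id by auto
  ultimately show ?case by blast
qed

lemma V_set_subset_subgroup: "V_set d G \<subseteq> H"
proof
  fix f assume f: "f \<in> V_set d G"
  interpret V: group "V_group d G" by (rule group_V_group)
  obtain n where bij: "bij_betw f (inf_words d) (inf_words d)" and off: "\<forall>w. w \<notin> inf_words d \<longrightarrow> f w = w"
    and n: "\<And>v. v \<in> words d \<Longrightarrow> length v = n \<Longrightarrow> \<exists>u\<in>words d. \<exists>g\<in>G. similar d f v u g"
    using f unfolding V_set_iff by blast
  \<comment> \<open>One extra level guarantees that the empty word is not in the partition, even
    when \<open>n\<close> is 0.\<close>
  have "\<exists>u\<in>words d. \<exists>g\<in>G. similar d f v u g" if v: "v \<in> words d" "length v = Suc n" for v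
  proof -
    obtain v' x where v': "v = v' @ [x]" "length v' = n" using v(2) by (metis length_Suc_conv_rev)
    then obtain u g where u: "u \<in> words d" "g \<in> G" "similar d f v' u g" using n[of v'] v(1) by auto
    then have "similar d f v (u @ g [x]) (tsection d g [x])"
      using similar_append[OF u(3,2), of "[x]"] v v' by auto
    moreover have "u @ g [x] \<in> words d" using u v v' tree_aut_words[OF G_aut[OF u(2)], of "[x]"] by simp
    moreover have "tsection d g [x] \<in> G" using G_tsection u v v' by simp
    ultimately show ?thesis by blast
  qed
  then obtain P' \<beta> \<gamma> where t: "table d G {v \<in> words d. length v = Suc n} P' \<beta> \<gamma> f"
    using table_of_level[OF bij off] by blast
  let ?P = "{v \<in> words d. length v = Suc n}"
  have "finite ?P" using cone_partition_finite[OF cone_partition_level] .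
  then obtain s \<gamma>' where s: "s \<in> H" and t': "table d G ?P P' \<beta> \<gamma>' (f \<circ> s)" and id: "\<forall>p\<in>?P. \<gamma>' p = id"
    using table_remove_labels[OF t, of ?P] by force
  from t' id have "table d G ?P P' \<beta> (\<lambda>_. id) (f \<circ> s)"
    using G_id by (auto simp: table_def)
  then have "f \<circ> s \<in> H" by (rule label_free_in_subgroup)
  then show "f \<in> H" using V.subgroup_cancel_right[OF H s] f by simp
qed

end

end

end

subsection \<open>The abelianization\<close>

definition torsion :: "('a, 'b) monoid_scheme \<Rightarrow> 'a set" where
  "torsion A = {a \<in> carrier A. \<exists>n::nat. n > 0 \<and> a [^]\<^bsub>A\<^esub> n = \<one>\<^bsub>A\<^esub>}"

lemma torsionI: "a \<in> carrier A \<Longrightarrow> (n::nat) > 0 \<Longrightarrow> a [^]\<^bsub>A\<^esub> n = \<one>\<^bsub>A\<^esub> \<Longrightarrow> a \<in> torsion A"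
  by (auto simp: torsion_def)

context comm_group
begin

lemma subgroup_torsion: "subgroup (torsion G) G"
proof (rule subgroupI)
  show "torsion G \<noteq> {}"
    using torsionI[of \<one> G 1] by auto
  fix a assume "a \<in> torsion G"
  then obtain n :: nat where a: "a \<in> carrier G" "n > 0" "a [^] n = \<one>" by (auto simp: torsion_def)
  then show "inv a \<in> torsion G" by (auto simp: torsion_def nat_pow_inv)
  fix b assume "b \<in> torsion G"
  then obtain m :: nat where b: "b \<in> carrier G" "m > 0" "b [^] m = \<one>" by (auto simp: torsion_def)
  have "a [^] (n * m) = \<one>" "b [^] (n * m) = \<one>"
    using a b by (metis nat_pow_pow nat_pow_one, metis nat_pow_pow nat_pow_one mult.commute)
  then have "(a \<otimes> b) [^] (n * m) = \<one>"
    using a b by (simp add: nat_pow_distrib)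
  then show "a \<otimes> b \<in> torsion G" using a b by (intro torsionI[of _ _ "n * m"]) auto
qed (auto simp: torsion_def)

lemma torsion_of_pow: "a \<in> carrier G \<Longrightarrow> m > 0 \<Longrightarrow> a [^] (m::nat) \<in> torsion G \<Longrightarrow> a \<in> torsion G"
  unfolding torsion_def using nat_pow_pow by (auto, metis nat_0_less_mult_iff)

text \<open>In an abelian group, the product of the cyclic group of \<open>b\<close> with
  \<open>generate G B\<close> is again a subgroup. It is finite because \<open>b\<close> has finite
  order, and it contains all generators.\<close>

lemma finite_generate_torsion:
  "finite B \<Longrightarrow> B \<subseteq> torsion G \<Longrightarrow> finite (generate G B)"
proof (induction B rule: finite_induct)
  case empty
  then show ?case by (simp add: generate_empty)
next
  case (insert b B)
  have b: "b \<in> carrier G" and B: "B \<subseteq> carrier G" using insert.prems by (auto simp: torsion_def)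
  have "finite (carrier (subgroup_generated G {b}))"
    using insert.prems b by (subst finite_cyclic_subgroup) (auto simp: torsion_def)
  then have fb: "finite (generate G {b})" using b by (simp add: carrier_subgroup_generated)
  let ?K = "generate G {b} <#> generate G B"
  have sb: "subgroup (generate G {b}) G" and sB: "subgroup (generate G B) G"
    using b B by (auto intro: generate_is_subgroup)
  have "subgroup ?K G" using mult_subgroups[OF sb sB] .
  moreover have "insert b B \<subseteq> ?K"
  proof -
    have "b \<otimes> \<one> \<in> ?K" unfolding set_mult_def using generate.incl[of b "{b}"] generate.one[of G B] by blast
    moreover have "c \<in> ?K" if c: "c \<in> B" for c
    proof -
      have "\<one> \<otimes> c \<in> ?K"
        unfolding set_mult_def using generate.incl[OF c] generate.one[of G "{b}"] by blast
      then show ?thesis using B c by (auto dest: subsetD)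
    qed
    ultimately show ?thesis using b B by auto
  qed
  ultimately have "generate G (insert b B) \<subseteq> ?K" by (intro generate_subgroup_incl)
  moreover have "finite ?K"
    using fb insert by (simp add: set_mult_def)
  ultimately show ?case using finite_subset by blast
qed

end

text \<open>If the first letters agree, another letter is free. If they differ and one word has a
  second letter, changing that letter gives a cone that avoids this word and, by its first letter,
  the other one too. Two one-letter words are excluded because for d = 2 they exhaust the
  space.\<close>

lemma parallel_third:
  assumes d: "d \<ge> 2" and uv: "parallel u v" and W: "u \<in> words d" "v \<in> words d"
    and len: "\<not> (length u = 1 \<and> length v = 1)"
  shows "\<exists>c\<in>words d. parallel u c \<and> parallel v c"
proof -
  have other: "\<exists>z<d. z \<noteq> x" for x
    using d by (cases "x = 0") (auto intro: exI[of _ 1] exI[of _ 0])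
  obtain x u' where u: "u = x # u'" using uv by (cases u) auto
  obtain y v' where v: "v = y # v'" using uv by (cases v) auto
  consider "x = y" | a t where "x \<noteq> y" "u' = a # t" | a t where "x \<noteq> y" "v' = a # t"
    using len u v by (cases u'; cases v') auto
  then show ?thesis
  proof cases
    case 1
    obtain z where z: "z < d" "z \<noteq> x" using other by blast
    then have "[z] \<in> words d" "parallel u [z]" "parallel v [z]" using 1 u v by (auto simp: parallel_def)
    then show ?thesis by blast
  next
    case (2 a t)
    obtain z where z: "z < d" "z \<noteq> a" using other by blast
    then have "[x, z] \<in> words d" "parallel u [x, z]" "parallel v [x, z]"
      using 2 u v W by (auto simp: parallel_def)
    then show ?thesis by blast
  next
    case (3 a t)
    obtain z where z: "z < d" "z \<noteq> a" using other by blast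
    then have "[y, z] \<in> words d" "parallel u [y, z]" "parallel v [y, z]"
      using 3 u v W by (auto simp: parallel_def)
    then show ?thesis by blast
  qed
qed

text \<open>The target stays an arbitrary abelian group, so that the argument never handles cosets;
  it becomes the quotient by the derived subgroup only at the very end.\<close>

locale V_abelian_hom = self_similar_group d G + Q: comm_group Q for d G and Q (structure) +
  fixes \<pi>
  assumes \<pi>_hom: "\<pi> \<in> hom (V_group d G) Q"
begin

sublocale \<pi>: group_hom "V_group d G" Q \<pi>
  using group_V_group \<pi>_hom by (simp add: group_hom_def group_hom_axioms_def Q.is_group)

lemma \<pi>_in: "a \<in> V_set d G \<Longrightarrow> \<pi> a \<in> carrier Q"
  using \<pi>.hom_closed by simp

lemma \<pi>_mult: "a \<in> V_set d G \<Longrightarrow> b \<in> V_set d G \<Longrightarrow> \<pi> (a \<circ> b) = \<pi> a \<otimes> \<pi> b"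
  using \<pi>.hom_mult by simp

lemma \<pi>_id: "\<pi> id = \<one>"
  using \<pi>.hom_one by simp

lemma \<pi>_conj:
  assumes "s \<in> V_set d G" "a \<in> V_set d G" "s \<circ> s = id"
  shows "\<pi> (s \<circ> a \<circ> s) = \<pi> a"
proof -
  have "\<pi> (s \<circ> a \<circ> s) = \<pi> a \<otimes> (\<pi> s \<otimes> \<pi> s)"
    using assms by (simp add: \<pi>_mult V_set_comp \<pi>_in Q.m_ac)
  also have "\<pi> s \<otimes> \<pi> s = \<one>" using assms by (metis \<pi>_mult \<pi>_id)
  finally show ?thesis by (simp only: Q.r_one \<pi>_in[OF assms(2)])
qed

lemma subgroup_preimage:
  assumes "subgroup K Q"
  shows "subgroup {f \<in> V_set d G. \<pi> f \<in> K} (V_group d G)"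
proof (rule \<pi>.subgroupI)
  show "{f \<in> V_set d G. \<pi> f \<in> K} \<noteq> {}"
    using V_set_id \<pi>_id subgroup.one_closed[OF assms] by auto
  show "a \<otimes>\<^bsub>V_group d G\<^esub> b \<in> {f \<in> V_set d G. \<pi> f \<in> K}"
    if "a \<in> {f \<in> V_set d G. \<pi> f \<in> K}" "b \<in> {f \<in> V_set d G. \<pi> f \<in> K}" for a b
    using that subgroup.m_closed[OF assms] by (auto simp: \<pi>_mult V_set_comp)
  show "inv\<^bsub>V_group d G\<^esub> a \<in> {f \<in> V_set d G. \<pi> f \<in> K}" if "a \<in> {f \<in> V_set d G. \<pi> f \<in> K}" for a
    using that subgroup.m_inv_closed[OF assms] group.inv_closed[OF group_V_group, of a] by auto
qed auto

section \<open>Classes of cone swaps\<close>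

lemma swap_class_third:
  assumes "parallel u v" "parallel u c" "parallel v c" "u \<in> words d" "v \<in> words d" "c \<in> words d"
  shows "\<pi> (cone_swap d u v) = \<pi> (cone_swap d u c)"
  using \<pi>_conj[OF cone_swap_in_V[of v c] cone_swap_in_V[of u v]] cone_swap_conj[OF assms]
    cone_swap_invol[of v c d] assms by simp

text \<open>One cone is exchanged at a time: c0, c1 becomes c0, e0 and then e0, e1. The third cone
  required at each exchange exists because \<open>c\<close> and \<open>e\<close> are
  disjoint.\<close>

lemma swap_class_siblings_parallel:
  assumes "parallel c e" "c \<in> words d" "e \<in> words d"
  shows "\<pi> (cone_swap d (c @ [0]) (c @ [1])) = \<pi> (cone_swap d (e @ [0]) (e @ [1]))"
proof -
  have W: "c @ [0] \<in> words d" "c @ [1] \<in> words d" "e @ [0] \<in> words d" "e @ [1] \<in> words d"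
    using assms d_ge_2 by auto
  have par: "parallel (c @ [i]) (e @ [j])" "parallel (e @ [j]) (c @ [i])" for i j
    using assms(1) by (meson parallel_append parallel_commute)+
  have sib: "parallel (b @ [0]) (b @ [1])" for b :: "nat list" by (auto simp: parallel_def)
  have "\<pi> (cone_swap d (c @ [0]) (c @ [1])) = \<pi> (cone_swap d (c @ [0]) (e @ [0]))"
    by (intro swap_class_third W par sib)
  also have "\<dots> = \<pi> (cone_swap d (e @ [0]) (c @ [0]))"
    using cone_swap_commute[OF par(1) W(1,3)] by simp
  also have "\<dots> = \<pi> (cone_swap d (e @ [0]) (e @ [1]))"
    by (intro swap_class_third W par sib)
  finally show ?thesis .
qed

lemma first_letter_parallel:
  fixes c :: "nat list"
  assumes "c \<noteq> []"
  shows "parallel c [0] \<or> parallel c [1]"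
  using assms by (cases c) (auto simp: parallel_def)

text \<open>A nonempty \<open>c\<close> is disjoint from \<open>[0]\<close> or from
  \<open>[1]\<close>, and these two are disjoint from each other, so the children of
  \<open>[0]\<close> are reached in at most two moves.\<close>

lemma swap_class_siblings:
  assumes "c \<in> words d" "c \<noteq> []"
  shows "\<pi> (cone_swap d (c @ [0]) (c @ [1])) = \<pi> (cone_swap d [0, 0] [0, 1])"
proof -
  have W: "[0] \<in> words d" "[1] \<in> words d" using d_ge_2 by auto
  have "parallel [1] [0::nat]" by (auto simp: parallel_def)
  then have "\<pi> (cone_swap d ([1] @ [0]) ([1] @ [1])) = \<pi> (cone_swap d ([0] @ [0]) ([0] @ [1]))"
    using swap_class_siblings_parallel W by blast
  then show ?thesis
    using first_letter_parallel[OF assms(2)] swap_class_siblings_parallel[OF _ assms(1)] W by fastforce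
qed

text \<open>With a third cone \<open>c\<close> available, the swap is moved into the children of
  \<open>c\<close>, where all classes agree. The one-letter pairs, for which no such
  \<open>c\<close> need exist, are simply listed.\<close>

lemma swap_class:
  assumes uv: "parallel u v" and W: "u \<in> words d" "v \<in> words d"
  shows "\<pi> (cone_swap d u v) \<in> insert (\<pi> (cone_swap d [0, 0] [0, 1]))
    ((\<lambda>(x, y). \<pi> (cone_swap d [x] [y])) ` ({..<d} \<times> {..<d}))"
proof (cases "length u = 1 \<and> length v = 1")
  case True
  then obtain x y where "u = [x]" "v = [y]" by (auto simp: length_Suc_conv)
  then show ?thesis using W by auto
next
  case False
  then obtain c where c: "c \<in> words d" "parallel u c" "parallel v c"
    using parallel_third[OF d_ge_2 uv W] by blast
  have W': "c @ [0] \<in> words d" "c @ [1] \<in> words d" using c d_ge_2 by auto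
  have par: "parallel u (c @ [i])" "parallel v (c @ [i])" "parallel (c @ [i]) u" for i
    using c parallel_append[of u c "[]" "[i]"] parallel_append[of v c "[]" "[i]"]
    by (auto simp: parallel_commute)
  have sib: "parallel (c @ [0]) (c @ [1])" by (auto simp: parallel_def)
  have "\<pi> (cone_swap d u v) = \<pi> (cone_swap d u (c @ [0]))"
    by (intro swap_class_third W W' par uv)
  also have "\<dots> = \<pi> (cone_swap d (c @ [0]) u)"
    using cone_swap_commute[OF par(1) W(1) W'(1)] by simp
  also have "\<dots> = \<pi> (cone_swap d (c @ [0]) (c @ [1]))"
    by (intro swap_class_third W W' par sib)
  also have "\<dots> = \<pi> (cone_swap d [0, 0] [0, 1])"
    using swap_class_siblings[OF c(1)] c(2) by fastforce
  finally show ?thesis by simp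
qed

lemma swap_class_torsion:
  assumes "parallel u v" "u \<in> words d" "v \<in> words d"
  shows "\<pi> (cone_swap d u v) \<in> torsion Q"
proof (rule torsionI[where n = 2])
  show "\<pi> (cone_swap d u v) [^] (2::nat) = \<one>"
    using \<pi>_mult[OF cone_swap_in_V[OF assms] cone_swap_in_V[OF assms]] cone_swap_invol[OF assms] \<pi>_id
      \<pi>_in[OF cone_swap_in_V[OF assms]] by (simp add: numeral_2_eq_2)
qed (use \<pi>_in[OF cone_swap_in_V[OF assms]] in auto)

section \<open>Classes of cone actions\<close>

definition \<phi> where "\<phi> g = \<pi> (cone_act d [0] g)"

lemma act_class_parallel:
  assumes "parallel u v" "u \<in> words d" "v \<in> words d" "g \<in> G"
  shows "\<pi> (cone_act d u g) = \<pi> (cone_act d v g)"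
  using \<pi>_conj[OF cone_swap_in_V[OF assms(1-3)] cone_act_in_V[OF assms(2,4)] cone_swap_invol[OF assms(1-3)]]
    cone_swap_act_conj[OF assms] by simp

text \<open>Makes the choice of \<open>[0]\<close> in \<open>\<phi>\<close> immaterial. The root
  cone is left out, since no cone is disjoint from it and no swap can move it.\<close>

lemma act_class:
  assumes "v \<in> words d" "v \<noteq> []" "g \<in> G"
  shows "\<pi> (cone_act d v g) = \<phi> g"
proof -
  have W: "[0] \<in> words d" "[1] \<in> words d" using d_ge_2 by auto
  have "parallel [1] [0::nat]" by (auto simp: parallel_def)
  then have "\<pi> (cone_act d [1] g) = \<pi> (cone_act d [0] g)"
    using act_class_parallel W assms by blast
  then show ?thesis
    using first_letter_parallel[OF assms(2)] act_class_parallel[OF _ assms(1) _ assms(3)] W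
    unfolding \<phi>_def by metis
qed

text \<open>Taking \<open>G\<close> as a group in its own right makes powers and generated subgroups
  transfer along \<open>\<phi>\<close>: the former carry finite order over to the classes, the
  latter reduce \<open>\<phi>\<close> to the generators of \<open>G\<close>.\<close>

sublocale \<phi>: group_hom "aut_group d\<lparr>carrier := G\<rparr>" Q \<phi>
proof -
  have "\<phi> \<in> hom (aut_group d\<lparr>carrier := G\<rparr>) Q"
  proof (rule homI)
    fix g h assume "g \<in> carrier (aut_group d\<lparr>carrier := G\<rparr>)" "h \<in> carrier (aut_group d\<lparr>carrier := G\<rparr>)"
    then have gh: "g \<in> G" "h \<in> G" by auto
    have W: "[0] \<in> words d" using d_ge_2 by simp
    show "\<phi> g \<in> carrier Q" unfolding \<phi>_def using gh W cone_act_in_V \<pi>_in by blast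
    have "\<phi> (g \<circ> h) = \<phi> g \<otimes> \<phi> h"
      unfolding \<phi>_def cone_act_comp[OF W gh(2), symmetric] using gh W cone_act_in_V \<pi>_mult by blast
    then show "\<phi> (g \<otimes>\<^bsub>aut_group d\<lparr>carrier := G\<rparr>\<^esub> h) = \<phi> g \<otimes> \<phi> h" by simp
  qed
  then show "group_hom (aut_group d\<lparr>carrier := G\<rparr>) Q \<phi>"
    using group.subgroup_imp_group[OF group_aut_group subgroup_G]
    by (simp add: group_hom_def group_hom_axioms_def Q.is_group)
qed

text \<open>Swaps are involutions, so the preimage of the torsion subgroup contains all of them and
  hence every label-free map.\<close>

lemma label_free_torsion:
  assumes "table d G P P' \<beta> (\<lambda>_. id) f"
  shows "\<pi> f \<in> torsion Q"
  using label_free_in_subgroup[OF subgroup_preimage[OF Q.subgroup_torsion] _ assms]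
    swap_class_torsion cone_swap_in_V by blast

text \<open>Written additively: let \<open>F\<close> act below each \<open>[0, x]\<close> by
  \<open>h x\<close>, the inverse of the section of \<open>g\<close> at \<open>x\<close>. The action
  of \<open>g\<close> on the cone of \<open>[0]\<close> after \<open>F\<close> is label-free, so
  \<open>\<phi> g\<close> + \<open>\<pi> F\<close> is torsion. Coarse diagonality makes every
  \<open>\<phi> (h x)\<close> + \<open>\<phi> g\<close> torsion; summing over the letters,
  \<open>\<pi> F\<close> + d \<open>\<phi> g\<close> is torsion. The difference is (d - 1)
  \<open>\<phi> g\<close>.\<close>

lemma \<phi>_torsion:
  assumes cd: "coarsely_diagonal d G" and g: "g \<in> G"
  shows "\<phi> g \<in> torsion Q"
proof -
  interpret A: group "aut_group d" by (rule group_aut_group)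
  define h where "h x = inv\<^bsub>aut_group d\<^esub> (tsection d g [x])" for x
  have sec: "tsection d g [x] \<in> G" "tsection d g [x] \<in> states d g" if "x < d" for x
    using G_tsection[of "[x]"] tsection_in_states[of "[x]"] g that by auto
  have h: "h x \<in> G" "tsection d g [x] \<circ> h x = id" if "x < d" for x
    using subgroup.m_inv_closed[OF subgroup_G sec(1)[OF that]] A.r_inv[of "tsection d g [x]"]
      G_aut[OF sec(1)[OF that]] by (auto simp: h_def)
  have \<phi>in: "\<phi> k \<in> carrier Q" if "k \<in> G" for k using \<phi>.hom_closed[of k] that by simp
  have \<phi>mult: "\<phi> (k \<circ> l) = \<phi> k \<otimes> \<phi> l" if "k \<in> G" "l \<in> G" for k l
    using \<phi>.hom_mult[of k l] that by simp
  have hg: "\<phi> (h x) \<otimes> \<phi> g \<in> torsion Q" if x: "x < d" for x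
  proof -
    obtain n :: nat where n: "n > 0" "(h x \<circ> g) [^]\<^bsub>aut_group d\<^esub> n = id"
      using cd g sec(2)[OF x] unfolding coarsely_diagonal_def h_def by auto
    \<comment> \<open>The power is moved into \<open>G\<close>, where \<open>\<phi>\<close> is known
      to be a homomorphism.\<close>
    then have "(h x \<circ> g) [^]\<^bsub>aut_group d\<lparr>carrier := G\<rparr>\<^esub> n = id"
      using A.nat_pow_consistent by metis
    then have "\<phi> (h x \<circ> g) [^] n = \<phi> id"
      using \<phi>.hom_nat_pow[of "h x \<circ> g" n] G_comp[OF h(1)[OF x] g] by simp
    also have "\<dots> = \<one>" using \<phi>.hom_one by simp
    finally show ?thesis
      using torsionI[OF _ n(1)] \<phi>in \<phi>mult G_comp h(1)[OF x] g by metis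
  qed
  have W: "[0] \<in> words d" using d_ge_2 by simp
  \<comment> \<open>\<open>F\<close> is the composite of \<open>cone_act d [0, x] (h x)\<close> over
    \<open>x < k\<close>. The induction records its pointwise effect together with its class, and
    pairs every new factor with one more \<open>\<phi> g\<close>.\<close>
  have "\<exists>F\<in>V_set d G. \<pi> F \<otimes> \<phi> g [^] k \<in> torsion Q
      \<and> (\<forall>x<d. \<forall>w\<in>inf_words d. F (cons_inf [0, x] w) = cons_inf [0, x] (if x < k then act_inf (h x) w else w))
      \<and> (\<forall>w. \<not> has_prefix w [0] \<longrightarrow> F w = w) \<and> (\<forall>w. w \<notin> inf_words d \<longrightarrow> F w = w)" if "k \<le> d" for k
    using that
  proof (induction k)
    case 0
    have "\<pi> id \<otimes> \<phi> g [^] (0::nat) \<in> torsion Q"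
      unfolding \<pi>_id using subgroup.one_closed[OF Q.subgroup_torsion] by simp
    moreover have "id (cons_inf [0, x] w) = cons_inf [0, x] (if x < 0 then act_inf (h x) w else w)" for x w
      by simp
    moreover have "id w = w" for w :: "nat \<Rightarrow> nat" by simp
    ultimately show ?case using V_set_id by blast
  next
    case (Suc k)
    then obtain F where F: "F \<in> V_set d G" "\<pi> F \<otimes> \<phi> g [^] k \<in> torsion Q"
      and Fx: "\<And>x w. x < d \<Longrightarrow> w \<in> inf_words d \<Longrightarrow>
        F (cons_inf [0, x] w) = cons_inf [0, x] (if x < k then act_inf (h x) w else w)"
      and Fo: "\<And>w. \<not> has_prefix w [0] \<Longrightarrow> F w = w" "\<And>w. w \<notin> inf_words d \<Longrightarrow> F w = w"
      by auto
    have k: "k < d" using Suc.prems by simp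
    let ?a = "cone_act d [0, k] (h k)"
    have Wk: "[0, k] \<in> words d" using k by simp
    have a: "?a \<in> V_set d G" using cone_act_in_V[OF Wk h(1)[OF k]] .
    have \<pi>a: "\<pi> ?a = \<phi> (h k)" using act_class[OF Wk _ h(1)[OF k]] by simp
    have "(\<pi> F \<otimes> \<phi> g [^] k) \<otimes> (\<phi> (h k) \<otimes> \<phi> g) \<in> torsion Q"
      using subgroup.m_closed[OF Q.subgroup_torsion F(2) hg[OF k]] .
    also have "(\<pi> F \<otimes> \<phi> g [^] k) \<otimes> (\<phi> (h k) \<otimes> \<phi> g) = \<pi> (F \<circ> ?a) \<otimes> \<phi> g [^] Suc k"
      using \<pi>_mult[OF F(1) a] \<pi>a \<pi>_in[OF F(1)] \<phi>in[OF g] \<phi>in[OF h(1)[OF k]] by (simp add: Q.m_ac)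
    finally have 1: "\<pi> (F \<circ> ?a) \<otimes> \<phi> g [^] Suc k \<in> torsion Q" .
    have 2: "(F \<circ> ?a) (cons_inf [0, x] w) = cons_inf [0, x] (if x < Suc k then act_inf (h x) w else w)"
      if x: "x < d" "w \<in> inf_words d" for x w
    proof (cases "x = k")
      case True
      then show ?thesis using Fx[OF k act_in[OF h(1)[OF k] x(2)]] cone_act_at[OF Wk x(2)] by simp
    next
      case False
      then have "parallel [0, x] [0, k]" by (auto simp: parallel_def)
      then have "?a (cons_inf [0, x] w) = cons_inf [0, x] w" by (simp add: cone_act_other)
      then show ?thesis using Fx[OF x] False by (simp add: less_Suc_eq)
    qed
    have 3: "(F \<circ> ?a) w = w" if "\<not> has_prefix w [0]" for w
    proof -
      have "\<not> has_prefix w [0, k]" using that by (auto simp: has_prefix_def)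
      then show ?thesis using Fo(1)[OF that] by (simp add: cone_act_other)
    qed
    have 4: "(F \<circ> ?a) w = w" if "w \<notin> inf_words d" for w
      using Fo(2) that by (simp add: cone_act_off)
    show ?case
      using V_set_comp[OF F(1) a] 1 2 3 4 by blast
  qed
  from this[OF order_refl] obtain F where F: "F \<in> V_set d G" "\<pi> F \<otimes> \<phi> g [^] d \<in> torsion Q"
    and Fx: "\<And>x w. x < d \<Longrightarrow> w \<in> inf_words d \<Longrightarrow> F (cons_inf [0, x] w) = cons_inf [0, x] (act_inf (h x) w)"
    and Fo: "\<And>w. \<not> has_prefix w [0] \<Longrightarrow> F w = w" "\<And>w. w \<notin> inf_words d \<Longrightarrow> F w = w"
    by auto
  let ?R = "cone_act d [0] g \<circ> F" and ?P = "{v \<in> words d. length v = 2}"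
  \<comment> \<open>Level 2 already contains all children of \<open>[0]\<close>. Below the letter 0
    the second letter is permuted as \<open>g\<close> does on the first level; all other words of
    length 2 are fixed.\<close>
  define \<beta> where "\<beta> p = (if hd p = 0 then 0 # g (tl p) else p)" for p
  have P: "cone_partition d ?P" by (rule cone_partition_level)
  have len2: "\<exists>a b. p = [a, b] \<and> a < d \<and> b < d" if "p \<in> ?P" for p
    using that by (auto simp: numeral_2_eq_2 length_Suc_conv)
  have g1: "g [b] \<in> words d" "length (g [b]) = 1" if "b < d" for b
    using tree_aut_words[OF G_aut[OF g], of "[b]"] tree_aut_length[OF G_aut[OF g], of "[b]"] that by auto
  have "\<beta> ` ?P \<subseteq> ?P"
    using g1 d_pos by (auto simp: \<beta>_def dest!: len2)
  moreover have "inj_on \<beta> ?P"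
  proof (rule inj_onI)
    fix p q assume pq: "p \<in> ?P" "q \<in> ?P" "\<beta> p = \<beta> q"
    then obtain a b a' b' where ab: "p = [a, b]" "q = [a', b']" "b < d" "b' < d" using len2 by metis
    have "g [b] = g [b'] \<Longrightarrow> b = b'" using tree_aut_inj[OF G_aut[OF g], of "[b]" "[b']"] ab by auto
    then show "p = q" using pq(3) ab by (auto simp: \<beta>_def split: if_splits)
  qed
  ultimately have \<beta>: "bij_betw \<beta> ?P ?P"
    using endo_inj_surj[OF cone_partition_finite[OF P]] by (auto simp: bij_betw_def)
  have "similar d ?R p (\<beta> p) id" if "p \<in> ?P" for p
  proof -
    obtain a b where ab: "p = [a, b]" "a < d" "b < d" using len2[OF \<open>p \<in> ?P\<close>] by blast
    have "?R (cons_inf p w) = cons_inf (\<beta> p) w" if w: "w \<in> inf_words d" for w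
    proof (cases "a = 0")
      case True
      have hw: "act_inf (h b) w \<in> inf_words d" using act_in[OF h(1)[OF ab(3)] w] .
      have "?R (cons_inf p w) = cone_act d [0] g (cons_inf ([0] @ [b]) (act_inf (h b) w))"
        using Fx[OF ab(3) w] ab True by simp
      also have "\<dots> = cons_inf [0] (act_inf g (cons_inf [b] (act_inf (h b) w)))"
        unfolding cons_inf_append using W hw ab by (intro cone_act_at) auto
      also have "act_inf g (cons_inf [b] (act_inf (h b) w)) = cons_inf (g [b]) (act_inf (tsection d g [b]) (act_inf (h b) w))"
        \<comment> \<open>The section that \<open>g\<close> leaves behind at \<open>b\<close> is the
          one that \<open>h b\<close> inverts, so nothing remains but the change of prefix.\<close>
        using act_inf_cons_inf[OF G_aut[OF g] _ hw] ab by simp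
      also have "act_inf (tsection d g [b]) (act_inf (h b) w) = w"
        using act_comp[OF h(1)[OF ab(3)] w] h(2)[OF ab(3)] by simp
      also have "cons_inf [0] (cons_inf (g [b]) w) = cons_inf (\<beta> p) w"
        using True ab cons_inf_append[of "[0]" "g [b]" w] by (simp add: \<beta>_def)
      finally show ?thesis .
    next
      case False
      then have "parallel p [0]" using ab by (auto simp: parallel_def)
      then show ?thesis using Fo(1) False ab by (simp add: cone_act_other \<beta>_def)
    qed
    then show ?thesis by (simp add: similar_def)
  qed
  then have "table d G ?P ?P \<beta> (\<lambda>_. id) ?R"
    using P \<beta> G_id Fo(2) by (auto simp: table_def cone_act_off)
  then have "\<pi> ?R \<in> torsion Q" by (rule label_free_torsion)
  then have R: "\<phi> g \<otimes> \<pi> F \<in> torsion Q"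
    using \<pi>_mult[OF cone_act_in_V[OF W g] F(1)] by (simp add: \<phi>_def)
  \<comment> \<open>\<open>m\<close> is d - 1. Its positivity, from \<open>d \<ge> 2\<close>, is
    what allows torsion of the power to descend to \<open>\<phi> g\<close>.\<close>
  obtain m where m: "d = Suc m" "m > 0" using d_ge_2 by (cases d) auto
  have in_Q: "\<phi> g \<in> carrier Q" "\<pi> F \<in> carrier Q" using \<phi>in[OF g] \<pi>_in[OF F(1)] by auto
  have pow_d: "x [^] d = x [^] m \<otimes> x" for x using m by simp
  have "\<pi> F \<otimes> \<phi> g [^] d = (\<phi> g \<otimes> \<pi> F) \<otimes> \<phi> g [^] m"
    using in_Q by (simp add: pow_d Q.m_ac)
  then have "\<phi> g [^] m \<in> torsion Q"
    using Q.subgroup_cancel_left[OF Q.subgroup_torsion R, of "\<phi> g [^] m"] F(2) in_Q by simp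
  then show ?thesis using Q.torsion_of_pow in_Q m by blast
qed

text \<open>The set \<open>B\<close> of swap classes and of the \<open>\<phi> s\<close> for
  generators \<open>s\<close> of \<open>G\<close> is finite and torsion, so it generates a finite
  subgroup. The preimage of that subgroup contains all swaps and all actions on proper cones, hence
  the whole group.\<close>

lemma finite_image:
  assumes fg: "finitely_generated (aut_group d) G" and cd: "coarsely_diagonal d G"
  shows "finite (\<pi> ` V_set d G)"
proof -
  interpret A: group "aut_group d" by (rule group_aut_group)
  obtain S where S: "finite S" "S \<subseteq> G" "generate (aut_group d) S = G"
    using fg by (auto simp: finitely_generated_def)
  define B1 where "B1 = {\<pi> (cone_swap d u v) |u v. parallel u v \<and> u \<in> words d \<and> v \<in> words d}"
  define B where "B = B1 \<union> \<phi> ` S"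
  have "B1 \<subseteq> insert (\<pi> (cone_swap d [0, 0] [0, 1])) ((\<lambda>(x, y). \<pi> (cone_swap d [x] [y])) ` ({..<d} \<times> {..<d}))"
    unfolding B1_def using swap_class by blast
  then have "finite B1" by (rule finite_subset) simp
  then have "finite B" using S by (simp add: B_def)
  moreover have BT: "B \<subseteq> torsion Q"
    unfolding B_def B1_def using swap_class_torsion \<phi>_torsion[OF cd] S by blast
  ultimately have fin: "finite (generate Q B)" by (rule Q.finite_generate_torsion)
  have sub: "subgroup (generate Q B) Q"
    using BT by (intro Q.generate_is_subgroup) (auto simp: torsion_def)
  have "\<phi> ` G = generate Q (\<phi> ` S)"
    using \<phi>.generate_img[of S] A.generate_consistent[OF S(2) subgroup_G] S by simp
  also have "\<dots> \<subseteq> generate Q B" by (rule Q.mono_generate) (simp add: B_def)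
  finally have \<phi>G: "\<phi> ` G \<subseteq> generate Q B" .
  have "V_set d G \<subseteq> {f \<in> V_set d G. \<pi> f \<in> generate Q B}"
  proof (rule V_set_subset_subgroup[OF subgroup_preimage[OF sub]])
    show "cone_swap d u v \<in> {f \<in> V_set d G. \<pi> f \<in> generate Q B}"
      if "parallel u v" "u \<in> words d" "v \<in> words d" for u v
      using cone_swap_in_V[OF that] that by (auto simp: B_def B1_def intro!: generate.incl)
    show "cone_act d v g \<in> {f \<in> V_set d G. \<pi> f \<in> generate Q B}"
      if "v \<in> words d" "v \<noteq> []" "g \<in> G" for v g
      using cone_act_in_V[OF that(1,3)] act_class[OF that] \<phi>G that(3) by auto
  qed
  then show ?thesis using fin by (auto intro: finite_subset)
qed

end

theorem theorem3p3:
  fixes d :: nat and G :: "(nat list \<Rightarrow> nat list) set"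
  assumes "d \<ge> 2"
    and "subgroup G (aut_group d)"
    and "finitely_generated (aut_group d) G"
    and "coarsely_diagonal d G"
    and "self_similar d G"
  shows "finite_abelianization (V_group d G)"
proof -
  interpret self_similar_group d G
    using assms by (simp add: self_similar_group_def)
  interpret V: group "V_group d G" by (rule group_V_group)
  let ?D = "derived (V_group d G) (carrier (V_group d G))"
  have "comm_group (V_group d G Mod ?D)" by (rule V.derived_quot_is_comm_group)
  moreover have "r_coset (V_group d G) ?D \<in> hom (V_group d G) (V_group d G Mod ?D)"
    using normal.r_coset_hom_Mod[OF V.derived_self_is_normal] .
  ultimately interpret V_abelian_hom d G "V_group d G Mod ?D" "r_coset (V_group d G) ?D"
    by (intro V_abelian_hom.intro V_abelian_hom_axioms.intro self_similar_group_axioms)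
  \<comment> \<open>The carrier of the quotient is the image of the coset map, so finiteness of that
    image is the claim itself.\<close>
  show ?thesis
    unfolding finite_abelianization_def carrier_FactGroup
    using finite_image[OF assms(3,4)] by simp
qed

end
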